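(* Let $n$ be a positive integer, $p$ a prime divisor of $2n$, $G$ a finite abelian group (written multiplicatively, identity $1$) of order $2n^2+2n+1$, and $H$ a subgroup of $G$ of prime index $v$. Let $f$ be the multiplicative order of $p$ modulo $v$, $l=\min\{i\ge 1: p^i\equiv\pm1\pmod v\}$, $d=(v-1)/f$, $m=\frac{2n^2+2n+1}{v}$, $m_1=\min\{i\in\mathbb{Z}_{\ge0}: i\equiv m\pmod p\}$, $m_2=\min\{i\in\mathbb{Z}_{\ge0}: i\equiv 2m\pmod p\}$, and $$\lambda=\max\{r\in\mathbb{Z}^+: r\mid p^l-1,\ \text{and } r\mid 2^i-p^j \text{ for all nonnegative integers } (i,j)\neq(0,0) \text{ with } 2^i\equiv p^j\pmod v\}.$$ Assume that $2n+1<m_1v$ and $2n+1<m_2v$, and that the automorphisms $\sigma_2$ and $\sigma_p$ generate the Galois group $\mathrm{Gal}(\mathbb{Q}(\zeta_v)/\mathbb{Q})$, where $\zeta_v$ is a primitive $v$-th root of unity and $\sigma_t:\zeta_v\mapsto\zeta_v^t$. Suppose there is $T=\sum_{g\in G}a_g g\in\mathbb{Z}[G]$ with all $a_g\in\{0,1\}$ such that $T=T^{(-1)}$ and $T^2=2G-T^{(2)}+2n$. Then: (i) $\lambda\neq 1$ and $\lambda\neq v$. (ii) There exists $x\in\{z\in\mathbb{F}_{p^l}: z^\lambda=1\}$ such that $m\sum_{y}\theta(x,y)=0$ in $\mathbb{F}_{p^f}$, the sum over all $y\in\mathbb{F}_{p^f}$ with $y^v=1$, and such that for every $y\in\mathbb{F}_{p^f}$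 with $y^v=1$ the element $m(1-\theta(x,y))$ equals the image in $\mathbb{F}_{p^f}$ of some integer in $\{0,1,\dots,m\}$. Here $$\theta(x,y)=\begin{cases}\sum_{i=0}^{v-2}(xy)^{2^i}, & \text{if } \langle\sigma_2\rangle=\mathrm{Gal}(\mathbb{Q}(\zeta_v)/\mathbb{Q}),\\ \sum_{i=0}^{d-1}\mathrm{Tr}_{\mathbb{F}_{p^f}/\mathbb{F}_p}\big((xy)^{2^i}\big), & \text{if } \langle\sigma_2,\sigma_p\rangle=\mathrm{Gal}(\mathbb{Q}(\zeta_v)/\mathbb{Q}) \text{ (otherwise)}.\end{cases}$$ (iii) In particular, when $H$ is the trivial subgroup (so $m=1$ and $v=2n^2+2n+1$), there exists $x\in\{z\in\mathbb{F}_{p^l}: z^\lambda=1\}$ such that $$|\{y\in\mathbb{F}_{p^f}: \theta(x,y)=1,\ y^{2n^2+2n+1}=1\}|=2n^2\quad\text{and}\quad|\{y\in\mathbb{F}_{p^f}: \theta(x,y)=0,\ y^{2n^2+2n+1}=1\}|=2n+1.$$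
   Context: For a finite group $G$, elements of $\mathbb{Z}[G]$ are written $\sum_g a_g g$; $G$ also denotes $\sum_{g\in G}g$, an integer $k$ denotes $k\cdot 1$, and $A^{(t)}=\sum_g a_g g^t$ for $A=\sum_g a_g g$. $\mathbb{F}_{q}$ is the finite field with $q$ elements, with $\mathbb{F}_{p^l}\subseteq\mathbb{F}_{p^f}$ (note $l\mid f$), and $\mathrm{Tr}_{\mathbb{F}_{p^f}/\mathbb{F}_p}$ is the field trace. *)

theory Defs
  imports
    "HOL-Number_Theory.Number_Theory"
    "HOL-Algebra.Algebra"
    "HOL-Algebra.Algebraic_Closure_Type"
begin

section \<open>The integral group ring of a finite group\<close>

text \<open>
  An element $\sum_g a_g g$ of the group ring is the coefficient function $g \mapsto a_g$,
  extensional on the carrier, so that equality in the ring is equality of functions.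
\<close>

definition zgr_of_int :: "('a, 'b) monoid_scheme \<Rightarrow> int \<Rightarrow> 'a \<Rightarrow> int" where
  "zgr_of_int G k = (\<lambda>g\<in>carrier G. if g = \<one>\<^bsub>G\<^esub> then k else 0)"

definition zgr_all :: "('a, 'b) monoid_scheme \<Rightarrow> 'a \<Rightarrow> int" where
  "zgr_all G = (\<lambda>g\<in>carrier G. 1)"

definition zgr_add :: "('a, 'b) monoid_scheme \<Rightarrow> ('a \<Rightarrow> int) \<Rightarrow> ('a \<Rightarrow> int) \<Rightarrow> 'a \<Rightarrow> int" where
  "zgr_add G A B = (\<lambda>g\<in>carrier G. A g + B g)"

definition zgr_diff :: "('a, 'b) monoid_scheme \<Rightarrow> ('a \<Rightarrow> int) \<Rightarrow> ('a \<Rightarrow> int) \<Rightarrow> 'a \<Rightarrow> int" where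
  "zgr_diff G A B = (\<lambda>g\<in>carrier G. A g - B g)"

definition zgr_mult :: "('a, 'b) monoid_scheme \<Rightarrow> ('a \<Rightarrow> int) \<Rightarrow> ('a \<Rightarrow> int) \<Rightarrow> 'a \<Rightarrow> int" where
  "zgr_mult G A B = (\<lambda>g\<in>carrier G.
     \<Sum>(h, k) | h \<in> carrier G \<and> k \<in> carrier G \<and> h \<otimes>\<^bsub>G\<^esub> k = g. A h * B k)"

text \<open>$A^{(t)} = \sum_h a_h h^t$: the coefficient at $g$ collects all $h$ with $h^t = g$.\<close>

definition zgr_power_map :: "('a, 'b) monoid_scheme \<Rightarrow> int \<Rightarrow> ('a \<Rightarrow> int) \<Rightarrow> 'a \<Rightarrow> int" where
  "zgr_power_map G t A = (\<lambda>g\<in>carrier G. \<Sum>h | h \<in> carrier G \<and> h [^]\<^bsub>G\<^esub> t = g. A h)"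


section \<open>Galois groups\<close>

text \<open>
  The automorphisms of the subfield \<open>L\<close> of \<open>R\<close> that fix \<open>F\<close> pointwise, under composition;
  as in \<^const>\<open>BijGroup\<close>, automorphisms are extensional on \<open>L\<close>.
\<close>

definition galois_group :: "('a, 'b) ring_scheme \<Rightarrow> 'a set \<Rightarrow> 'a set \<Rightarrow> ('a \<Rightarrow> 'a) monoid" where
  "galois_group R L F =
     BijGroup L \<lparr>carrier :=
       {\<sigma> \<in> Bij L. \<sigma> \<in> ring_iso (R\<lparr>carrier := L\<rparr>) (R\<lparr>carrier := L\<rparr>) \<and> (\<forall>a\<in>F. \<sigma> a = a)}\<rparr>"

abbreviation complex_ring :: "complex ring" where
  "complex_ring \<equiv> ring_of_type_algebra"

definition cyclotomic_field :: "complex \<Rightarrow> complex set" where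
  "cyclotomic_field \<zeta> = generate_field complex_ring (insert \<zeta> \<rat>)"

definition cyclotomic_gal :: "complex \<Rightarrow> (complex \<Rightarrow> complex) monoid" where
  "cyclotomic_gal \<zeta> = galois_group complex_ring (cyclotomic_field \<zeta>) \<rat>"

text \<open>
  For a primitive $v$-th root of unity \<open>\<zeta>\<close> and \<open>t\<close> coprime to $v$ there is exactly one automorphism of
  $\mathbf{Q}(\zeta)$ sending \<open>\<zeta>\<close> to $\zeta^t$; for other \<open>t\<close> the value is meaningless.
\<close>

definition cyclotomic_sigma :: "complex \<Rightarrow> nat \<Rightarrow> complex \<Rightarrow> complex" where
  "cyclotomic_sigma \<zeta> t = (THE \<sigma>. \<sigma> \<in> carrier (cyclotomic_gal \<zeta>) \<and> \<sigma> \<zeta> = \<zeta> ^ t)"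

definition primitive_root_of_unity :: "nat \<Rightarrow> complex \<Rightarrow> bool" where
  "primitive_root_of_unity v \<zeta> \<longleftrightarrow> \<zeta> ^ v = 1 \<and> (\<forall>k. 0 < k \<and> k < v \<longrightarrow> \<zeta> ^ k \<noteq> 1)"


section \<open>Traces of finite fields and the function theta\<close>

text \<open>
  The trace from a field \<open>K\<close> with $q^r$ elements to its subfield with $q$ elements, as the sum
  of the conjugates $z, z^q, \dots, z^{q^{r-1}}$.
\<close>

definition finite_field_trace ::
  "('k, 'c) ring_scheme \<Rightarrow> nat \<Rightarrow> nat \<Rightarrow> 'k \<Rightarrow> 'k" where
  "finite_field_trace K q r z = (\<Oplus>\<^bsub>K\<^esub>j\<in>{..<r}. z [^]\<^bsub>K\<^esub> (q ^ j))"

definition theta ::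
  "complex \<Rightarrow> nat \<Rightarrow> nat \<Rightarrow> nat \<Rightarrow> nat \<Rightarrow> ('k, 'c) ring_scheme \<Rightarrow> 'k \<Rightarrow> 'k \<Rightarrow> 'k" where
  "theta \<zeta> v p f d K x y =
     (if generate (cyclotomic_gal \<zeta>) {cyclotomic_sigma \<zeta> 2} = carrier (cyclotomic_gal \<zeta>)
      then (\<Oplus>\<^bsub>K\<^esub>i\<in>{..<v - 1}. (x \<otimes>\<^bsub>K\<^esub> y) [^]\<^bsub>K\<^esub> ((2::nat) ^ i))
      else (\<Oplus>\<^bsub>K\<^esub>i\<in>{..<d}. finite_field_trace K p f ((x \<otimes>\<^bsub>K\<^esub> y) [^]\<^bsub>K\<^esub> ((2::nat) ^ i))))"

end

theory Submission
  imports Defs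
begin

text \<open>
  Since \<open>p\<close> divides \<open>2n\<close>, the equation for \<open>T\<close> says modulo \<open>p\<close> that every nonprincipal character \<open>\<chi>\<close> of
  \<open>G/H\<close> with values in characteristic \<open>p\<close> satisfies $\chi(T)^2 = -\chi(T^{(2)})$, and the Frobenius map gives
  $\chi(T)^p = \chi(T^{(p)})$. With $x_t = -\chi(T^{(t)})$ this reads $x_{2t} = x_t^2$ and $x_{pt} = x_t^p$,
  so, as 2 and \<open>p\<close> generate the residues modulo \<open>v\<close>, all $x_t$ are powers of $x = x_1$, namely
  $x_t = x^{2^i p^j}$ for $t \equiv 2^i p^j$. Fourier inversion then recovers the coefficients of the
  image of \<open>T\<close> in \<open>\<int>[G/H]\<close> modulo \<open>p\<close> as $m(1 - \theta(x,y))$. These coefficients are nonnegative with sum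
  $2n+1$, so the two size assumptions exclude $x = 0$ and $x = 1$, and the order of \<open>x\<close> divides \<open>\<lambda>\<close>.
  Finally $x^v = 1$ is impossible: $T = T^{(-1)}$ would give $x = x^{-1}$, hence $x = 1$ as \<open>v\<close> is odd.
\<close>

section \<open>Automorphisms of prime cyclotomic fields\<close>

text \<open>The generation hypothesis concerns automorphisms of Q(zeta_v). To turn it into a
  statement about residues modulo \<open>v\<close>, sigma_t must exist for every t prime to
  \<open>v\<close>, which amounts to the irreducibility of the v-th cyclotomic polynomial. The bound
  on \<open>m2\<close> forces \<open>p\<close> to be odd: for p = 2 the least residue of 2m would be
  0. Hence \<open>p\<close> divides n itself, so mv = 2n(n+1) + 1 is 1 modulo \<open>p\<close>. Thus
  \<open>m\<close> is the inverse of \<open>v\<close> needed in Fourier inversion, and the sign in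
  x_t is compatible with p-th powers. The conditions defining lambda are closed under least common
  multiples, so the maximal admissible r is a multiple of all the others; the order of x is
  admissible because 2^i = p^j modulo \<open>v\<close> forces x^(2^i) = x^(p^j). Part (i) mentions
  no field, while the type \<open>'k\<close> in the other parts may carry no field with p^f
  elements. The argument is therefore carried out over an abstract domain and used twice: in an
  algebraic closure of Z/p, which always exists, and in the given finite field.\<close>

abbreviation ieval :: "complex \<Rightarrow> int poly \<Rightarrow> complex" where
  "ieval u q \<equiv> poly (map_poly of_int q) u"

lemma ieval_add [simp]: "ieval u (p + q) = ieval u p + ieval u q"
proof -
  have "map_poly of_int (p + q) = map_poly of_int p + (map_poly of_int q :: complex poly)"
    by (rule poly_eqI) (simp add: coeff_map_poly)
  then show ?thesis by simp
qed

lemma ieval_mult [simp]: "ieval u (p * q) = ieval u p * ieval u q"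
proof -
  have "map_poly of_int (p * q) = map_poly of_int p * (map_poly of_int q :: complex poly)"
    by (rule poly_eqI) (simp add: coeff_map_poly coeff_mult)
  then show ?thesis by simp
qed

lemma ieval_uminus [simp]: "ieval u (- p) = - ieval u p"
proof -
  have "map_poly of_int (- p) = - (map_poly of_int p :: complex poly)"
    by (rule poly_eqI) (simp add: coeff_map_poly)
  then show ?thesis by simp
qed

lemma ieval_diff [simp]: "ieval u (p - q) = ieval u p - ieval u q"
  using ieval_add[of p "- q" u] by simp

lemma ieval_pCons [simp]: "ieval u (pCons a p) = of_int a + u * ieval u p"
  by (cases "a = 0 \<and> p = 0") (auto simp: map_poly_pCons)

lemma ieval_1 [simp]: "ieval u 1 = 1"
  by (simp add: map_poly_pCons one_pCons del: ieval_pCons)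

lemma ieval_smult [simp]: "ieval u (Polynomial.smult c q) = of_int c * ieval u q"
  using ieval_mult[of "[:c:]" q u] by simp

lemma ieval_power [simp]: "ieval u (p ^ k) = ieval u p ^ k"
  by (induction k) auto

lemma ieval_pcompose [simp]: "ieval u (pcompose q r) = ieval (ieval u r) q"
  by (induction q) (auto simp: pcompose_pCons)

section \<open>Irreducibility of the cyclotomic polynomial of prime index\<close>

lemma eisenstein_irreducible:
  fixes F :: "int poly" and q :: int
  assumes q: "Factorial_Ring.prime q" and lc: "lead_coeff F = 1" and deg: "degree F > 0"
    and low: "\<And>i. i < degree F \<Longrightarrow> q dvd coeff F i" and sq: "\<not> q * q dvd coeff F 0"
  shows "Factorial_Ring.irreducible F"
proof (rule Factorial_Ring.irreducibleI)
  show "F \<noteq> 0" using deg by auto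
  show "\<not> F dvd 1" using deg by (auto simp: is_unit_poly_iff)
  \<comment> \<open>Since q*q does not divide the constant term, q divides the constant term of
    exactly one factor; \<open>key\<close> treats one of the two symmetric cases.\<close>
  have key: "g dvd 1" if fac: "F = f * g" and f0: "q dvd coeff f 0" and g0: "\<not> q dvd coeff g 0" for f g
  proof -
    have nz: "f \<noteq> 0" "g \<noteq> 0" using fac deg by auto
    have lcs: "lead_coeff f * lead_coeff g = 1"
      using lc unfolding fac by (simp add: lead_coeff_mult)
    have dF: "degree F = degree f + degree g" using nz fac by (simp add: degree_mult_eq)
    have "\<not> q dvd lead_coeff f"
      using lcs q by (metis dvd_mult2 not_prime_unit)
    \<comment> \<open>At the first coefficient of f not divisible by q, the product has coefficient
      f_i g_0 modulo q, which is nonzero. So i is at least deg F, f takes up the whole degree, and g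
      is a constant dividing the leading coefficient 1.\<close>
    define i where "i = (LEAST i. \<not> q dvd coeff f i)"
    have i: "\<not> q dvd coeff f i" unfolding i_def by (rule LeastI) fact
    have ile: "i \<le> degree f" unfolding i_def by (rule Least_le) fact
    have small: "q dvd coeff f j" if "j < i" for j using that not_less_Least unfolding i_def by blast
    have "coeff F i = (\<Sum>j\<le>i. coeff f j * coeff g (i - j))"
      unfolding fac by (rule coeff_mult)
    also have "\<dots> = (\<Sum>j<i. coeff f j * coeff g (i - j)) + coeff f i * coeff g 0"
      by (simp flip: lessThan_Suc_atMost)
    finally have "coeff F i = (\<Sum>j<i. coeff f j * coeff g (i - j)) + coeff f i * coeff g 0" .
    moreover have "q dvd (\<Sum>j<i. coeff f j * coeff g (i - j))"
      by (intro dvd_sum dvd_mult2 small) auto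
    moreover have "\<not> q dvd coeff f i * coeff g 0"
      using i g0 q by (simp add: prime_dvd_mult_iff)
    ultimately have "\<not> q dvd coeff F i" by (simp add: dvd_add_right_iff)
    then have "i \<ge> degree F" using low by (meson not_le)
    then have "degree g = 0" using ile dF by linarith
    then obtain c where c: "g = [:c:]" by (meson degree_eq_zeroE)
    have "c dvd 1" using lcs c by (metis dvd_triv_right lead_coeff_pCons(2))
    then show ?thesis using c by (simp add: is_unit_const_poly_iff)
  qed
  fix f g assume fac: "F = f * g"
  have c0: "coeff F 0 = coeff f 0 * coeff g 0" unfolding fac by (simp add: coeff_mult)
  then have "q dvd coeff f 0 * coeff g 0" using low[OF deg] by simp
  then have "q dvd coeff f 0 \<or> q dvd coeff g 0" using q by (simp add: prime_dvd_mult_iff)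
  moreover have "\<not> (q dvd coeff f 0 \<and> q dvd coeff g 0)"
    using sq c0 by (auto intro: mult_dvd_mono)
  ultimately show "f dvd 1 \<or> g dvd 1"
    using key[of f g] key[of g f] fac by (auto simp: mult.commute)
qed

text \<open>A substitute for minimal polynomials inside Z[X]: with g of least degree among the
  nonzero polynomials vanishing at u, pseudo-division makes g divide every such polynomial up to a
  nonzero integer factor. F is prime of positive degree and divides no nonzero constant, so these
  factors can be cancelled.\<close>

lemma irreducible_dvd_if_common_root:
  fixes F q :: "int poly"
  assumes F: "Factorial_Ring.irreducible F" "degree F > 0" and Fu: "ieval u F = 0" and qu: "ieval u q = 0"
  shows "F dvd q"
proof (cases "q = 0")
  case False
  have prF: "prime_elem F" using F(1) by (simp add: prime_elem_iff_irreducible)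
  define P where "P = (\<lambda>g. g \<noteq> 0 \<and> ieval u g = 0)"
  define g where "g = (ARG_MIN degree g. P g)"
  have "P q" using False qu by (simp add: P_def)
  then have g: "P g" and gmin: "\<And>r. P r \<Longrightarrow> degree g \<le> degree r"
    using arg_min_nat_lemma[of P q degree] by (auto simp: g_def)
  then have g0: "g \<noteq> 0" and gu: "ieval u g = 0" by (auto simp: P_def)
  have quot: "\<exists>c s. c \<noteq> 0 \<and> Polynomial.smult c r = g * s" if "ieval u r = 0" for r
  proof -
    obtain s t where st: "pseudo_divmod r g = (s, t)" by fastforce
    from pseudo_divmod[OF g0 st] have eq: "Polynomial.smult (coeff g (degree g) ^ (Suc (degree r) - degree g)) r = g * s + t"
      and t: "t = 0 \<or> degree t < degree g" by auto
    have "ieval u t = 0" using arg_cong[OF eq, of "ieval u"] that gu by simp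
    then have "t = 0" using t gmin[of t] unfolding P_def by linarith
    then show ?thesis using eq g0 by (intro exI[of _ "coeff g (degree g) ^ (Suc (degree r) - degree g)"] exI[of _ s]) auto
  qed
  have no_const: "\<not> F dvd [:c:]" if "c \<noteq> 0" for c :: int
    using that F(2) by (auto dest!: dvd_imp_degree_le)
  have "F dvd g"
  proof -
    obtain c s where c: "c \<noteq> 0" "Polynomial.smult c F = g * s" using quot[OF Fu] by blast
    have "F dvd g * s" using c(2) by (metis dvd_smult dvd_refl)
    then consider "F dvd g" | "F dvd s" using prF by (auto simp: prime_elem_dvd_mult_iff)
    then show ?thesis
    proof cases
      case 2
      then obtain s' where "s = F * s'" by blast
      then have "F * [:c:] = F * (g * s')" using c(2) by (simp add: mult_ac)
      then have "[:c:] = g * s'" using F(2) by (metis degree_0 less_irrefl mult_cancel_left)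
      then have gs: "g * s' = [:c:]" by simp
      then have "degree (g * s') = 0" by simp
      moreover have "g \<noteq> 0" "s' \<noteq> 0" using gs c(1) by auto
      ultimately have "degree g = 0" by (simp add: degree_mult_eq)
      then obtain b where "g = [:b:]" by (meson degree_eq_zeroE)
      then show ?thesis using gu g0 by simp
    qed
  qed
  moreover obtain c s where "c \<noteq> 0" "Polynomial.smult c q = g * s" using quot[OF qu] by blast
  ultimately have "F dvd [:c:] * q" by simp
  then show ?thesis using prF no_const[OF \<open>c \<noteq> 0\<close>] by (metis prime_elem_dvd_mult_iff)
qed simp

text \<open>The $v$-th cyclotomic polynomial shifted by one, $((X+1)^v - 1)/X$, which is Eisenstein at the prime $v$.\<close>

definition shifted_cyclotomic :: "nat \<Rightarrow> int poly" where
  "shifted_cyclotomic v = (\<Sum>i<v. Polynomial.monom (of_nat (v choose Suc i)) i)"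

lemma coeff_shifted_cyclotomic: "coeff (shifted_cyclotomic v) i = of_nat (v choose Suc i)"
  by (simp add: shifted_cyclotomic_def coeff_sum binomial_eq_0)

lemma degree_shifted_cyclotomic: "v > 0 \<Longrightarrow> degree (shifted_cyclotomic v) = v - 1"
  by (rule antisym; (rule degree_le | rule le_degree))
     (auto simp: coeff_shifted_cyclotomic binomial_eq_0)

lemma irreducible_shifted_cyclotomic:
  assumes "Factorial_Ring.prime v"
  shows "Factorial_Ring.irreducible (shifted_cyclotomic v)"
proof (rule eisenstein_irreducible[of "int v"])
  have v: "v > 1" using assms prime_gt_1_nat by auto
  show "lead_coeff (shifted_cyclotomic v) = 1" "degree (shifted_cyclotomic v) > 0"
    using v by (auto simp: degree_shifted_cyclotomic coeff_shifted_cyclotomic)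
  show "int v dvd coeff (shifted_cyclotomic v) i" if "i < degree (shifted_cyclotomic v)" for i
    using that v assms by (simp add: degree_shifted_cyclotomic coeff_shifted_cyclotomic dvd_choose_prime)
  have "\<not> v * v dvd v" using v by (auto dest: dvd_imp_le)
  then show "\<not> int v * int v dvd coeff (shifted_cyclotomic v) 0"
    unfolding coeff_shifted_cyclotomic by (simp flip: of_nat_mult)
qed (use assms in simp)

lemma shifted_cyclotomic_mult: "pCons 0 (shifted_cyclotomic v) = [:1, 1:] ^ v - 1"
proof (rule poly_eqI)
  fix n
  show "coeff (pCons 0 (shifted_cyclotomic v)) n = coeff ([:1, 1:] ^ v - 1) n"
  proof (cases n)
    case 0
    have "coeff ([:1, 1 :: int:] ^ v) 0 = 1"
      by (induction v) (auto simp: coeff_mult)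
    then show ?thesis using 0 by simp
  next
    case (Suc k)
    have "coeff ([:1, 1 :: int:] ^ v) j = of_nat (v choose j)" for j
    proof (cases "j \<le> v")
      case True then show ?thesis by (simp add: coeff_linear_poly_power)
    next
      case False
      then show ?thesis
        by (intro trans[OF coeff_eq_0]) (auto simp: degree_linear_power binomial_eq_0)
    qed
    then show ?thesis using Suc by (simp add: coeff_shifted_cyclotomic)
  qed
qed

lemma ieval_shifted_cyclotomic:
  assumes "z ^ v = 1" "z \<noteq> 1"
  shows "ieval (z - 1) (shifted_cyclotomic v) = 0"
  using arg_cong[OF shifted_cyclotomic_mult[of v], of "ieval (z - 1)"] assms by simp

text \<open>All nontrivial v-th roots of unity are conjugate: q shifted by one vanishes at z - 1,
  hence is a multiple of the irreducible \<open>shifted_cyclotomic v\<close>, which vanishes at w -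
  1 as well.\<close>

lemma ieval_conjugate_root:
  assumes v: "Factorial_Ring.prime v" and z: "z ^ v = 1" "z \<noteq> 1" and w: "w ^ v = 1" "w \<noteq> 1"
    and q: "ieval z q = 0"
  shows "ieval w q = 0"
proof -
  have v1: "v > 1" using v prime_gt_1_nat by auto
  have "ieval (z - 1) (pcompose q [:1, 1:]) = 0" using q by simp
  then have "shifted_cyclotomic v dvd pcompose q [:1, 1:]"
    using irreducible_dvd_if_common_root[OF irreducible_shifted_cyclotomic[OF v]]
      ieval_shifted_cyclotomic[OF z] v1 by (simp add: degree_shifted_cyclotomic)
  then obtain r where "pcompose q [:1, 1:] = shifted_cyclotomic v * r" by blast
  from arg_cong[OF this, of "ieval (w - 1)"] show ?thesis
    using ieval_shifted_cyclotomic[OF w] by simp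
qed

section \<open>The cyclotomic field inside the complex numbers\<close>

lemma complex_ring_simps [simp]:
  "carrier complex_ring = UNIV" "x \<otimes>\<^bsub>complex_ring\<^esub> y = x * y" "x \<oplus>\<^bsub>complex_ring\<^esub> y = x + y"
  "\<one>\<^bsub>complex_ring\<^esub> = 1" "\<zero>\<^bsub>complex_ring\<^esub> = 0"
  by (simp_all add: ring_of_type_algebra_def)

lemma complex_ring_a_inv [simp]: "\<ominus>\<^bsub>complex_ring\<^esub> x = - x"
proof -
  interpret field complex_ring by (rule field_from_type_algebra)
  show ?thesis by (rule minus_equality) simp_all
qed

lemma complex_ring_m_inv [simp]: "x \<noteq> 0 \<Longrightarrow> inv\<^bsub>complex_ring\<^esub> x = inverse x"
proof -
  interpret field complex_ring by (rule field_from_type_algebra)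
  assume "x \<noteq> 0"
  then show ?thesis by (intro comm_inv_char) simp_all
qed

lemma one_in_cyclotomic_field: "1 \<in> cyclotomic_field \<zeta>"
  using generate_field.one[of complex_ring "insert \<zeta> \<rat>"] unfolding cyclotomic_field_def by simp

lemma gen_in_cyclotomic_field: "\<zeta> \<in> cyclotomic_field \<zeta>"
  unfolding cyclotomic_field_def by (rule generate_field.incl) simp

lemma Rats_subset_cyclotomic_field: "q \<in> \<rat> \<Longrightarrow> q \<in> cyclotomic_field \<zeta>"
  unfolding cyclotomic_field_def by (rule generate_field.incl) simp

lemma cyclotomic_field_add:
  "x \<in> cyclotomic_field \<zeta> \<Longrightarrow> y \<in> cyclotomic_field \<zeta> \<Longrightarrow> x + y \<in> cyclotomic_field \<zeta>"
  using generate_field.eng_add[of x complex_ring "insert \<zeta> \<rat>" y]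
  unfolding cyclotomic_field_def by simp

lemma cyclotomic_field_mult:
  "x \<in> cyclotomic_field \<zeta> \<Longrightarrow> y \<in> cyclotomic_field \<zeta> \<Longrightarrow> x * y \<in> cyclotomic_field \<zeta>"
  using generate_field.eng_mult[of x complex_ring "insert \<zeta> \<rat>" y]
  unfolding cyclotomic_field_def by simp

lemma cyclotomic_field_inverse: "x \<in> cyclotomic_field \<zeta> \<Longrightarrow> inverse x \<in> cyclotomic_field \<zeta>"
  using generate_field.m_inv[of x complex_ring "insert \<zeta> \<rat>"]
  unfolding cyclotomic_field_def by (cases "x = 0") simp_all

lemma cyclotomic_field_divide: "x \<in> cyclotomic_field \<zeta> \<Longrightarrow> y \<in> cyclotomic_field \<zeta> \<Longrightarrow> x / y \<in> cyclotomic_field \<zeta>"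
  by (simp add: divide_inverse cyclotomic_field_mult cyclotomic_field_inverse)

lemma ieval_in_cyclotomic_field: "ieval \<zeta> q \<in> cyclotomic_field \<zeta>"
proof (induction q)
  case (pCons a q)
  have "of_int a \<in> cyclotomic_field \<zeta>" by (rule Rats_subset_cyclotomic_field) simp
  then show ?case
    unfolding ieval_pCons
    by (intro cyclotomic_field_add cyclotomic_field_mult gen_in_cyclotomic_field pCons.IH)
qed (simp add: Rats_subset_cyclotomic_field)

text \<open>Quotients of integer polynomial values are closed under the field operations and contain
  the rationals, so induction over the generated field applies. In this form an automorphism can be
  written down without a basis of the field.\<close>

lemma cyclotomic_field_fraction:
  assumes "x \<in> cyclotomic_field \<zeta>"
  obtains A B where "ieval \<zeta> B \<noteq> 0" "x = ieval \<zeta> A / ieval \<zeta> B"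
proof -
  have "\<exists>A B. ieval \<zeta> B \<noteq> 0 \<and> x = ieval \<zeta> A / ieval \<zeta> B"
    using assms unfolding cyclotomic_field_def
  proof (induction rule: generate_field.induct)
    case one
    show ?case by (rule exI[of _ 1], rule exI[of _ 1]) simp
  next
    case (incl h)
    then consider "h = \<zeta>" | "h \<in> \<rat>" by auto
    then show ?case
    proof cases
      case 1
      then show ?thesis by (intro exI[of _ "[:0, 1:]"] exI[of _ 1]) simp
    next
      case 2
      then obtain a b where "b > 0" "h = of_int a / of_int b" by (rule Rats_cases') auto
      then show ?thesis by (intro exI[of _ "[:a:]"] exI[of _ "[:b:]"]) simp
    qed
  next
    case (a_inv h)
    then obtain A B where "ieval \<zeta> B \<noteq> 0" "h = ieval \<zeta> A / ieval \<zeta> B" by blast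
    then show ?case by (intro exI[of _ "- A"] exI[of _ B]) simp
  next
    case (m_inv h)
    then obtain A B where "ieval \<zeta> B \<noteq> 0" "h = ieval \<zeta> A / ieval \<zeta> B" by blast
    then show ?case using m_inv by (intro exI[of _ B] exI[of _ A]) auto
  next
    case (eng_add h1 h2)
    then obtain A B C D where "ieval \<zeta> B \<noteq> 0" "h1 = ieval \<zeta> A / ieval \<zeta> B"
      "ieval \<zeta> D \<noteq> 0" "h2 = ieval \<zeta> C / ieval \<zeta> D" by blast
    then show ?case by (intro exI[of _ "A * D + C * B"] exI[of _ "B * D"]) (simp add: add_frac_eq)
  next
    case (eng_mult h1 h2)
    then obtain A B C D where "ieval \<zeta> B \<noteq> 0" "h1 = ieval \<zeta> A / ieval \<zeta> B"
      "ieval \<zeta> D \<noteq> 0" "h2 = ieval \<zeta> C / ieval \<zeta> D" by blast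
    then show ?case by (intro exI[of _ "A * C"] exI[of _ "B * D"]) simp
  qed
  then show ?thesis using that by blast
qed

section \<open>The automorphisms sigma_t and their exponents\<close>

lemma cyclotomic_gal_carrierI:
  assumes "bij_betw \<sigma> (cyclotomic_field \<zeta>) (cyclotomic_field \<zeta>)" "\<sigma> \<in> extensional (cyclotomic_field \<zeta>)"
    and "\<And>x y. x \<in> cyclotomic_field \<zeta> \<Longrightarrow> y \<in> cyclotomic_field \<zeta> \<Longrightarrow> \<sigma> (x * y) = \<sigma> x * \<sigma> y"
    and "\<And>x y. x \<in> cyclotomic_field \<zeta> \<Longrightarrow> y \<in> cyclotomic_field \<zeta> \<Longrightarrow> \<sigma> (x + y) = \<sigma> x + \<sigma> y"
    and "\<And>a. a \<in> \<rat> \<Longrightarrow> \<sigma> a = a"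
  shows "\<sigma> \<in> carrier (cyclotomic_gal \<zeta>)"
proof -
  have "\<sigma> \<in> ring_iso (complex_ring\<lparr>carrier := cyclotomic_field \<zeta>\<rparr>) (complex_ring\<lparr>carrier := cyclotomic_field \<zeta>\<rparr>)"
    unfolding ring_iso_def
    using assms(1) by (auto intro!: ring_hom_memI simp: assms(3-5) bij_betw_apply[OF assms(1)])
  then show ?thesis
    using assms(1,2,5) by (simp add: cyclotomic_gal_def galois_group_def Bij_def)
qed

lemma cyclotomic_galD:
  assumes "\<sigma> \<in> carrier (cyclotomic_gal \<zeta>)"
  shows "\<sigma> \<in> Bij (cyclotomic_field \<zeta>)"
    "\<And>x. x \<in> cyclotomic_field \<zeta> \<Longrightarrow> \<sigma> x \<in> cyclotomic_field \<zeta>"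
    "\<And>x y. x \<in> cyclotomic_field \<zeta> \<Longrightarrow> y \<in> cyclotomic_field \<zeta> \<Longrightarrow> \<sigma> (x * y) = \<sigma> x * \<sigma> y"
    "\<And>x y. x \<in> cyclotomic_field \<zeta> \<Longrightarrow> y \<in> cyclotomic_field \<zeta> \<Longrightarrow> \<sigma> (x + y) = \<sigma> x + \<sigma> y"
    "\<And>a. a \<in> \<rat> \<Longrightarrow> \<sigma> a = a"
proof -
  have 1: "\<sigma> \<in> Bij (cyclotomic_field \<zeta>)" "\<forall>a\<in>\<rat>. \<sigma> a = a"
    and 2: "\<sigma> \<in> ring_hom (complex_ring\<lparr>carrier := cyclotomic_field \<zeta>\<rparr>) (complex_ring\<lparr>carrier := cyclotomic_field \<zeta>\<rparr>)"
    using assms by (simp_all add: cyclotomic_gal_def galois_group_def ring_iso_def)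
  show "\<sigma> \<in> Bij (cyclotomic_field \<zeta>)" "\<And>a. a \<in> \<rat> \<Longrightarrow> \<sigma> a = a" using 1 by auto
  show "\<And>x. x \<in> cyclotomic_field \<zeta> \<Longrightarrow> \<sigma> x \<in> cyclotomic_field \<zeta>"
    "\<And>x y. x \<in> cyclotomic_field \<zeta> \<Longrightarrow> y \<in> cyclotomic_field \<zeta> \<Longrightarrow> \<sigma> (x * y) = \<sigma> x * \<sigma> y"
    "\<And>x y. x \<in> cyclotomic_field \<zeta> \<Longrightarrow> y \<in> cyclotomic_field \<zeta> \<Longrightarrow> \<sigma> (x + y) = \<sigma> x + \<sigma> y"
    using ring_hom_closed[OF 2] ring_hom_mult[OF 2] ring_hom_add[OF 2] by simp_all
qed

lemma cyclotomic_gal_mult: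
  assumes "\<sigma> \<in> carrier (cyclotomic_gal \<zeta>)" "\<tau> \<in> carrier (cyclotomic_gal \<zeta>)"
  shows "\<sigma> \<otimes>\<^bsub>cyclotomic_gal \<zeta>\<^esub> \<tau> = compose (cyclotomic_field \<zeta>) \<sigma> \<tau>"
  using cyclotomic_galD(1)[OF assms(1)] cyclotomic_galD(1)[OF assms(2)]
  by (simp add: cyclotomic_gal_def galois_group_def BijGroup_def)

lemma cyclotomic_gal_one: "\<one>\<^bsub>cyclotomic_gal \<zeta>\<^esub> = (\<lambda>x\<in>cyclotomic_field \<zeta>. x)"
  by (simp add: cyclotomic_gal_def galois_group_def BijGroup_def)

lemma cyclotomic_gal_fraction:
  assumes \<sigma>: "\<sigma> \<in> carrier (cyclotomic_gal \<zeta>)" and B: "ieval \<zeta> B \<noteq> 0"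
  shows "\<sigma> (ieval \<zeta> A / ieval \<zeta> B) = ieval (\<sigma> \<zeta>) A / ieval (\<sigma> \<zeta>) B"
proof -
  note D = cyclotomic_galD[OF \<sigma>]
  have poly: "\<sigma> (ieval \<zeta> C) = ieval (\<sigma> \<zeta>) C" for C
    by (induction C)
       (simp_all add: D ieval_in_cyclotomic_field gen_in_cyclotomic_field cyclotomic_field_mult
          Rats_subset_cyclotomic_field)
  have "\<sigma> (ieval \<zeta> B) \<noteq> 0"
  proof -
    have "inj_on \<sigma> (cyclotomic_field \<zeta>)" using D(1) by (simp add: Bij_def bij_betw_def)
    moreover have "0 \<in> cyclotomic_field \<zeta>" "\<sigma> 0 = 0" using D(5) Rats_subset_cyclotomic_field by auto
    ultimately show ?thesis using B ieval_in_cyclotomic_field by (metis inj_on_eq_iff)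
  qed
  moreover have "\<sigma> (ieval \<zeta> A / ieval \<zeta> B) * \<sigma> (ieval \<zeta> B) = \<sigma> (ieval \<zeta> A)"
    using B D(3)[of "ieval \<zeta> A / ieval \<zeta> B" "ieval \<zeta> B"]
    by (simp add: cyclotomic_field_divide ieval_in_cyclotomic_field)
  ultimately show ?thesis by (simp add: poly field_simps)
qed

lemma cyclotomic_gal_eqI:
  assumes "\<sigma> \<in> carrier (cyclotomic_gal \<zeta>)" "\<tau> \<in> carrier (cyclotomic_gal \<zeta>)" "\<sigma> \<zeta> = \<tau> \<zeta>"
  shows "\<sigma> = \<tau>"
proof (rule extensionalityI)
  show "\<sigma> \<in> extensional (cyclotomic_field \<zeta>)" "\<tau> \<in> extensional (cyclotomic_field \<zeta>)"
    using assms cyclotomic_galD(1) Bij_imp_extensional by blast+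
  fix x assume "x \<in> cyclotomic_field \<zeta>"
  then show "\<sigma> x = \<tau> x"
    by (rule cyclotomic_field_fraction) (simp add: assms cyclotomic_gal_fraction)
qed

lemma primitive_root_power_eq_iff:
  assumes "primitive_root_of_unity v \<zeta>" "v > 0"
  shows "\<zeta> ^ a = \<zeta> ^ b \<longleftrightarrow> [a = b] (mod v)"
proof -
  have z: "\<zeta> ^ v = 1" "\<And>k. 0 < k \<Longrightarrow> k < v \<Longrightarrow> \<zeta> ^ k \<noteq> 1"
    using assms by (auto simp: primitive_root_of_unity_def)
  have nz: "\<zeta> \<noteq> 0" using z(1) assms(2) by (auto simp: power_0_left)
  have red: "\<zeta> ^ a = \<zeta> ^ (a mod v)" for a
  proof -
    have "\<zeta> ^ a = \<zeta> ^ (v * (a div v) + a mod v)" by simp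
    also have "\<dots> = \<zeta> ^ (a mod v)" unfolding power_add power_mult z(1) by simp
    finally show ?thesis .
  qed
  have inj: "i = j" if "i \<le> j" "j < v" "\<zeta> ^ i = \<zeta> ^ j" for i j
  proof -
    have "\<zeta> ^ j = \<zeta> ^ i * \<zeta> ^ (j - i)" unfolding power_add[symmetric] using that by simp
    then have "\<zeta> ^ (j - i) = 1" using that nz by simp
    then show ?thesis using z(2)[of "j - i"] that by (cases "i = j") auto
  qed
  have "\<zeta> ^ a = \<zeta> ^ b \<longleftrightarrow> \<zeta> ^ (a mod v) = \<zeta> ^ (b mod v)" using red by metis
  also have "\<dots> \<longleftrightarrow> a mod v = b mod v"
    using inj[of "a mod v" "b mod v"] inj[of "b mod v" "a mod v"] assms(2)
    by (metis linear mod_less_divisor)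
  finally show ?thesis by (simp add: cong_def)
qed

lemma ieval_conjugate_power_iff:
  assumes v: "Factorial_Ring.prime v" and \<zeta>: "primitive_root_of_unity v \<zeta>" and t: "coprime t v"
  shows "ieval (\<zeta> ^ t) q = 0 \<longleftrightarrow> ieval \<zeta> q = 0"
proof -
  have v1: "v > 1" using v prime_gt_1_nat by auto
  have "\<zeta> ^ v = 1" using \<zeta> by (simp add: primitive_root_of_unity_def)
  then have "(\<zeta> ^ t) ^ v = 1" by (metis mult.commute power_mult power_one)
  have "\<zeta> \<noteq> 1" "\<zeta> ^ t \<noteq> 1"
    using primitive_root_power_eq_iff[OF \<zeta>, of 1 0] primitive_root_power_eq_iff[OF \<zeta>, of t 0] v1 t
    by (auto simp: cong_0_iff dvd_imp_le coprime_absorb_right)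
  then show ?thesis
    using ieval_conjugate_root[OF v] \<open>\<zeta> ^ v = 1\<close> \<open>(\<zeta> ^ t) ^ v = 1\<close> by blast
qed

text \<open>The automorphism sends A(zeta)/B(zeta) to A(zeta^t)/B(zeta^t). An integer polynomial
  vanishes at zeta iff it vanishes at zeta^t: one direction makes this well defined, the other gives
  injectivity and keeps denominators nonzero.\<close>

lemma cyclotomic_gal_exists:
  assumes v: "Factorial_Ring.prime v" and \<zeta>: "primitive_root_of_unity v \<zeta>" and t: "coprime t v"
  shows "\<exists>\<sigma>. \<sigma> \<in> carrier (cyclotomic_gal \<zeta>) \<and> \<sigma> \<zeta> = \<zeta> ^ t"
proof -
  define F where "F = cyclotomic_field \<zeta>"
  have v1: "v > 1" using v prime_gt_1_nat by auto
  note iff = ieval_conjugate_power_iff[OF v \<zeta> t]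
  \<comment> \<open>\<open>rel\<close> is the graph of the intended map, and \<open>SOME\<close>
    picks one value. By \<open>frac\<close> the fraction chosen is irrelevant: A*D - C*B vanishes at
    zeta, hence at zeta^t.\<close>
  define rel where "rel = (\<lambda>x y. \<exists>A B. ieval \<zeta> B \<noteq> 0 \<and> x = ieval \<zeta> A / ieval \<zeta> B
     \<and> y = ieval (\<zeta> ^ t) A / ieval (\<zeta> ^ t) B)"
  define \<sigma> where "\<sigma> = (\<lambda>x\<in>F. SOME y. rel x y)"
  have frac: "\<sigma> (ieval \<zeta> A / ieval \<zeta> B) = ieval (\<zeta> ^ t) A / ieval (\<zeta> ^ t) B"
    if B: "ieval \<zeta> B \<noteq> 0" for A B
  proof -
    let ?x = "ieval \<zeta> A / ieval \<zeta> B"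
    have "rel ?x (ieval (\<zeta> ^ t) A / ieval (\<zeta> ^ t) B)" using B unfolding rel_def by blast
    then have "rel ?x (SOME y. rel ?x y)" by (rule someI)
    then obtain C D where CD: "ieval \<zeta> D \<noteq> 0" "?x = ieval \<zeta> C / ieval \<zeta> D"
      "(SOME y. rel ?x y) = ieval (\<zeta> ^ t) C / ieval (\<zeta> ^ t) D" unfolding rel_def by blast
    have "ieval \<zeta> (A * D - C * B) = 0" using CD B by (simp add: field_simps)
    then have "ieval (\<zeta> ^ t) (A * D - C * B) = 0" using iff by blast
    then have "ieval (\<zeta> ^ t) A / ieval (\<zeta> ^ t) B = ieval (\<zeta> ^ t) C / ieval (\<zeta> ^ t) D"
      using CD(1) B iff by (simp add: field_simps)
    then show ?thesis
      using CD(3) by (simp add: \<sigma>_def F_def cyclotomic_field_divide ieval_in_cyclotomic_field)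
  qed
  have fracs: "\<exists>A B. ieval \<zeta> B \<noteq> 0 \<and> ieval (\<zeta> ^ t) B \<noteq> 0 \<and> x = ieval \<zeta> A / ieval \<zeta> B
      \<and> \<sigma> x = ieval (\<zeta> ^ t) A / ieval (\<zeta> ^ t) B" if "x \<in> F" for x
    using that cyclotomic_field_fraction[of x \<zeta>] frac iff unfolding F_def by metis
  have rat: "\<sigma> a = a" if "a \<in> \<rat>" for a
  proof -
    from that obtain b c where "c > 0" "a = of_int b / of_int c" by (rule Rats_cases') auto
    then show ?thesis using frac[of "[:c:]" "[:b:]"] by simp
  qed
  have add: "\<sigma> (x + y) = \<sigma> x + \<sigma> y" if "x \<in> F" "y \<in> F" for x y
  proof -
    from fracs[OF that(1)] obtain A B where 1: "ieval \<zeta> B \<noteq> 0" "ieval (\<zeta> ^ t) B \<noteq> 0"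
      "x = ieval \<zeta> A / ieval \<zeta> B" "\<sigma> x = ieval (\<zeta> ^ t) A / ieval (\<zeta> ^ t) B" by blast
    from fracs[OF that(2)] obtain C D where 2: "ieval \<zeta> D \<noteq> 0" "ieval (\<zeta> ^ t) D \<noteq> 0"
      "y = ieval \<zeta> C / ieval \<zeta> D" "\<sigma> y = ieval (\<zeta> ^ t) C / ieval (\<zeta> ^ t) D" by blast
    have "x + y = ieval \<zeta> (A * D + C * B) / ieval \<zeta> (B * D)" using 1 2 by (simp add: add_frac_eq)
    then have "\<sigma> (x + y) = ieval (\<zeta> ^ t) (A * D + C * B) / ieval (\<zeta> ^ t) (B * D)"
      using frac[of "B * D" "A * D + C * B"] 1 2 by simp
    then show ?thesis using 1 2 by (simp add: add_frac_eq)
  qed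
  have mult: "\<sigma> (x * y) = \<sigma> x * \<sigma> y" if "x \<in> F" "y \<in> F" for x y
  proof -
    from fracs[OF that(1)] obtain A B where 1: "ieval \<zeta> B \<noteq> 0" "ieval (\<zeta> ^ t) B \<noteq> 0"
      "x = ieval \<zeta> A / ieval \<zeta> B" "\<sigma> x = ieval (\<zeta> ^ t) A / ieval (\<zeta> ^ t) B" by blast
    from fracs[OF that(2)] obtain C D where 2: "ieval \<zeta> D \<noteq> 0" "ieval (\<zeta> ^ t) D \<noteq> 0"
      "y = ieval \<zeta> C / ieval \<zeta> D" "\<sigma> y = ieval (\<zeta> ^ t) C / ieval (\<zeta> ^ t) D" by blast
    have "x * y = ieval \<zeta> (A * C) / ieval \<zeta> (B * D)" using 1 2 by simp
    then have "\<sigma> (x * y) = ieval (\<zeta> ^ t) (A * C) / ieval (\<zeta> ^ t) (B * D)"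
      using frac[of "B * D" "A * C"] 1 2 by simp
    then show ?thesis using 1 2 by simp
  qed
  have "bij_betw \<sigma> F F"
    unfolding bij_betw_def
  proof
    have zero: "x = 0" if "x \<in> F" "\<sigma> x = 0" for x
    proof -
      from fracs[OF that(1)] obtain A B where "ieval (\<zeta> ^ t) B \<noteq> 0"
        "x = ieval \<zeta> A / ieval \<zeta> B" "\<sigma> x = ieval (\<zeta> ^ t) A / ieval (\<zeta> ^ t) B" by blast
      then show ?thesis using that(2) iff[of A] by simp
    qed
    have minus: "- x \<in> F" if "x \<in> F" for x
      using cyclotomic_field_mult[of "-1" \<zeta> x] Rats_subset_cyclotomic_field[of "-1" \<zeta>] that
      by (simp add: F_def)
    show "inj_on \<sigma> F"
    proof (rule inj_onI)
      fix x y assume xy: "x \<in> F" "y \<in> F" "\<sigma> x = \<sigma> y"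
      have "\<sigma> (- y) + \<sigma> y = 0" using add[of "- y" y] minus xy rat[of 0] by simp
      then have "\<sigma> (x + - y) = 0" using add[of x "- y"] minus xy by (simp add: add.commute)
      moreover have "x + - y \<in> F" using cyclotomic_field_add[of x \<zeta> "- y"] minus xy by (simp add: F_def)
      ultimately have "x + - y = 0" using zero by blast
      then show "x = y" by simp
    qed
    show "\<sigma> ` F = F"
    proof
      show "\<sigma> ` F \<subseteq> F"
      proof
        fix y assume "y \<in> \<sigma> ` F"
        then obtain A B where "y = ieval (\<zeta> ^ t) A / ieval (\<zeta> ^ t) B" using fracs by blast
        moreover have "ieval (\<zeta> ^ t) C = ieval \<zeta> (pcompose C ([:0, 1:] ^ t))" for C by simp
        ultimately show "y \<in> F"
          unfolding F_def by (metis cyclotomic_field_divide ieval_in_cyclotomic_field)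
      qed
      show "F \<subseteq> \<sigma> ` F"
      proof
        fix x assume x: "x \<in> F"
        \<comment> \<open>With s inverse to t modulo \<open>v\<close>, substituting X^s into A and B
          yields a preimage, because evaluation at zeta^t undoes the substitution.\<close>
        obtain s where s: "[t * s = 1] (mod v)" using cong_solve_coprime_nat[OF t] by auto
        then have "\<zeta> ^ (t * s) = \<zeta>" using primitive_root_power_eq_iff[OF \<zeta>, of "t * s" 1] v1 by simp
        then have ts: "ieval (\<zeta> ^ t) (pcompose C ([:0, 1:] ^ s)) = ieval \<zeta> C" for C
          by (simp flip: power_mult)
        from x obtain A B where AB: "ieval \<zeta> B \<noteq> 0" "x = ieval \<zeta> A / ieval \<zeta> B"
          unfolding F_def using cyclotomic_field_fraction by blast
        have "ieval (\<zeta> ^ t) (pcompose B ([:0, 1:] ^ s)) \<noteq> 0" using AB ts by presburger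
        then have nz: "ieval \<zeta> (pcompose B ([:0, 1:] ^ s)) \<noteq> 0" using iff by blast
        have "\<sigma> (ieval \<zeta> (pcompose A ([:0, 1:] ^ s)) / ieval \<zeta> (pcompose B ([:0, 1:] ^ s))) = x"
          using frac[OF nz] AB(2) ts by presburger
        moreover have "ieval \<zeta> (pcompose A ([:0, 1:] ^ s)) / ieval \<zeta> (pcompose B ([:0, 1:] ^ s)) \<in> F"
          unfolding F_def by (intro cyclotomic_field_divide ieval_in_cyclotomic_field)
        ultimately show "x \<in> \<sigma> ` F" by blast
      qed
    qed
  qed
  then have "\<sigma> \<in> carrier (cyclotomic_gal \<zeta>)"
    by (intro cyclotomic_gal_carrierI) (use add mult rat in \<open>auto simp: F_def \<sigma>_def\<close>)
  moreover have "\<sigma> \<zeta> = \<zeta> ^ t" using frac[of 1 "[:0, 1:]"] by simp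
  ultimately show ?thesis by blast
qed

lemma cyclotomic_sigma:
  assumes v: "Factorial_Ring.prime v" and \<zeta>: "primitive_root_of_unity v \<zeta>" and t: "coprime t v"
  shows "cyclotomic_sigma \<zeta> t \<in> carrier (cyclotomic_gal \<zeta>)" "cyclotomic_sigma \<zeta> t \<zeta> = \<zeta> ^ t"
proof -
  have "\<exists>!\<sigma>. \<sigma> \<in> carrier (cyclotomic_gal \<zeta>) \<and> \<sigma> \<zeta> = \<zeta> ^ t"
    using cyclotomic_gal_exists[OF assms] cyclotomic_gal_eqI[of _ \<zeta>] by metis
  from theI'[OF this] show "cyclotomic_sigma \<zeta> t \<in> carrier (cyclotomic_gal \<zeta>)"
    "cyclotomic_sigma \<zeta> t \<zeta> = \<zeta> ^ t" unfolding cyclotomic_sigma_def by auto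
qed

lemma cyclotomic_gal_power:
  assumes \<sigma>: "\<sigma> \<in> carrier (cyclotomic_gal \<zeta>)" and x: "x \<in> cyclotomic_field \<zeta>"
  shows "\<sigma> (x ^ k) = \<sigma> x ^ k"
proof -
  have pow: "x ^ k \<in> cyclotomic_field \<zeta>" for k
    by (induction k) (auto intro: cyclotomic_field_mult x one_in_cyclotomic_field)
  show ?thesis
    by (induction k) (simp_all add: cyclotomic_galD[OF \<sigma>] pow x)
qed

lemma cyclotomic_gal_one_closed: "\<one>\<^bsub>cyclotomic_gal \<zeta>\<^esub> \<in> carrier (cyclotomic_gal \<zeta>)"
  unfolding cyclotomic_gal_one
proof (rule cyclotomic_gal_carrierI)
  show "bij_betw (\<lambda>x\<in>cyclotomic_field \<zeta>. x) (cyclotomic_field \<zeta>) (cyclotomic_field \<zeta>)"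
    using id_Bij[of "cyclotomic_field \<zeta>"] by (simp add: Bij_def)
qed (simp_all add: cyclotomic_field_add cyclotomic_field_mult Rats_subset_cyclotomic_field)

lemma cyclotomic_gal_mult_closed:
  assumes "\<sigma> \<in> carrier (cyclotomic_gal \<zeta>)" "\<tau> \<in> carrier (cyclotomic_gal \<zeta>)"
  shows "\<sigma> \<otimes>\<^bsub>cyclotomic_gal \<zeta>\<^esub> \<tau> \<in> carrier (cyclotomic_gal \<zeta>)"
  unfolding cyclotomic_gal_mult[OF assms]
proof (rule cyclotomic_gal_carrierI)
  note 1 = cyclotomic_galD[OF assms(1)] and 2 = cyclotomic_galD[OF assms(2)]
  show "bij_betw (compose (cyclotomic_field \<zeta>) \<sigma> \<tau>) (cyclotomic_field \<zeta>) (cyclotomic_field \<zeta>)"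
    using compose_Bij[OF 1(1) 2(1)] by (simp add: Bij_def)
  show "compose (cyclotomic_field \<zeta>) \<sigma> \<tau> (x * y)
      = compose (cyclotomic_field \<zeta>) \<sigma> \<tau> x * compose (cyclotomic_field \<zeta>) \<sigma> \<tau> y"
    "compose (cyclotomic_field \<zeta>) \<sigma> \<tau> (x + y)
      = compose (cyclotomic_field \<zeta>) \<sigma> \<tau> x + compose (cyclotomic_field \<zeta>) \<sigma> \<tau> y"
    if "x \<in> cyclotomic_field \<zeta>" "y \<in> cyclotomic_field \<zeta>" for x y
    using that by (simp_all add: compose_eq cyclotomic_field_add cyclotomic_field_mult 1(3,4) 2(2-4))
  show "compose (cyclotomic_field \<zeta>) \<sigma> \<tau> a = a" if "a \<in> \<rat>" for a
    using that by (simp add: compose_eq Rats_subset_cyclotomic_field 1 2)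
qed simp

text \<open>By Fermat, t^(v-2) inverts t modulo \<open>v\<close>. Writing the inverse as a power of
  t keeps its exponent in any multiplicatively closed set containing t. The inverse is unique
  because sigma is injective and automorphisms are determined on zeta.\<close>

lemma cyclotomic_gal_inv:
  assumes v: "Factorial_Ring.prime v" and \<zeta>: "primitive_root_of_unity v \<zeta>" and t: "coprime t v"
    and \<sigma>: "\<sigma> \<in> carrier (cyclotomic_gal \<zeta>)" "\<sigma> \<zeta> = \<zeta> ^ t"
  shows "inv\<^bsub>cyclotomic_gal \<zeta>\<^esub> \<sigma> \<in> carrier (cyclotomic_gal \<zeta>)"
    "(inv\<^bsub>cyclotomic_gal \<zeta>\<^esub> \<sigma>) \<zeta> = \<zeta> ^ (t ^ (v - 2))"
proof -
  define s where "s = t ^ (v - 2)"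
  have v2: "v \<ge> 2" using v prime_ge_2_nat by auto
  have "v - 1 = Suc (v - 2)" using v2 by simp
  then have "s * t = t ^ (v - 1)" unfolding s_def by (simp only: power_Suc2)
  moreover have "[t ^ (v - 1) = 1] (mod v)"

    using fermat_theorem[OF v, of t] t v2 coprime_absorb_right[of v t] by auto
  ultimately have st: "[s * t = 1] (mod v)" by simp
  have "coprime s v" unfolding s_def using t by simp
  then obtain \<tau> where \<tau>: "\<tau> \<in> carrier (cyclotomic_gal \<zeta>)" "\<tau> \<zeta> = \<zeta> ^ s"
    using cyclotomic_gal_exists[OF v \<zeta>] by blast
  have z: "\<zeta> ^ (s * t) = \<zeta>"
    using primitive_root_power_eq_iff[OF \<zeta>, of "s * t" 1] st v2 by simp
  let ?G = "cyclotomic_gal \<zeta>"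
  have one: "\<rho> \<otimes>\<^bsub>?G\<^esub> \<rho>' = \<one>\<^bsub>?G\<^esub>" if "\<rho> \<in> carrier ?G" "\<rho>' \<in> carrier ?G" "\<rho> (\<rho>' \<zeta>) = \<zeta>" for \<rho> \<rho>'
    by (rule cyclotomic_gal_eqI[OF cyclotomic_gal_mult_closed[OF that(1,2)] cyclotomic_gal_one_closed])
       (simp add: cyclotomic_gal_mult that compose_eq gen_in_cyclotomic_field cyclotomic_gal_one)
  have inv: "\<sigma> \<otimes>\<^bsub>?G\<^esub> \<tau> = \<one>\<^bsub>?G\<^esub>" "\<tau> \<otimes>\<^bsub>?G\<^esub> \<sigma> = \<one>\<^bsub>?G\<^esub>"
    using z cyclotomic_gal_power[OF \<sigma>(1) gen_in_cyclotomic_field] cyclotomic_gal_power[OF \<tau>(1) gen_in_cyclotomic_field]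
    by (auto intro!: one simp: \<sigma> \<tau> mult.commute simp flip: power_mult)
  have "inv\<^bsub>?G\<^esub> \<sigma> = \<tau>"
    unfolding m_inv_def
  proof (rule the_equality)
    show "\<tau> \<in> carrier ?G \<and> \<sigma> \<otimes>\<^bsub>?G\<^esub> \<tau> = \<one>\<^bsub>?G\<^esub> \<and> \<tau> \<otimes>\<^bsub>?G\<^esub> \<sigma> = \<one>\<^bsub>?G\<^esub>" using \<tau> inv by blast
    fix \<rho> assume \<rho>: "\<rho> \<in> carrier ?G \<and> \<sigma> \<otimes>\<^bsub>?G\<^esub> \<rho> = \<one>\<^bsub>?G\<^esub> \<and> \<rho> \<otimes>\<^bsub>?G\<^esub> \<sigma> = \<one>\<^bsub>?G\<^esub>"
    have r: "\<rho> \<zeta> \<in> cyclotomic_field \<zeta>" using \<rho> cyclotomic_galD(2) gen_in_cyclotomic_field by blast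
    have "\<sigma> (\<rho> \<zeta>) = \<sigma> (\<tau> \<zeta>)"

    proof -
      have "(\<sigma> \<otimes>\<^bsub>?G\<^esub> \<rho>) \<zeta> = (\<sigma> \<otimes>\<^bsub>?G\<^esub> \<tau>) \<zeta>" using inv(1) \<rho> by simp
      moreover have "(\<sigma> \<otimes>\<^bsub>?G\<^esub> \<rho>') \<zeta> = \<sigma> (\<rho>' \<zeta>)" if "\<rho>' \<in> carrier ?G" for \<rho>'
        using that \<sigma>(1) by (simp add: cyclotomic_gal_mult compose_eq gen_in_cyclotomic_field)
      ultimately show ?thesis using \<rho> \<tau>(1) by metis
    qed
    then have "\<rho> \<zeta> = \<tau> \<zeta>"
      using cyclotomic_galD(1)[OF \<sigma>(1)] r cyclotomic_galD(2)[OF \<tau>(1) gen_in_cyclotomic_field]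
      by (auto simp: Bij_def bij_betw_def inj_on_eq_iff)
    then show "\<rho> = \<tau>" using cyclotomic_gal_eqI \<rho> \<tau> by blast
  qed
  then show "inv\<^bsub>?G\<^esub> \<sigma> \<in> carrier ?G" "(inv\<^bsub>?G\<^esub> \<sigma>) \<zeta> = \<zeta> ^ (t ^ (v - 2))"
    using \<tau> by (auto simp: s_def)
qed

text \<open>On zeta, composition multiplies exponents and inversion raises them to the power v - 2,
  so everything generated has an exponent in \<open>S\<close>. As sigma_t is generated for each t
  prime to \<open>v\<close>, t is congruent to an element of \<open>S\<close>. The set is left
  general to cover both the powers of 2 and the products 2^i p^j.\<close>

lemma residues_generated_if_galois_generated:
  assumes v: "Factorial_Ring.prime v" and \<zeta>: "primitive_root_of_unity v \<zeta>"
    and A: "\<And>a. a \<in> A \<Longrightarrow> coprime a v"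
    and gen: "generate (cyclotomic_gal \<zeta>) (cyclotomic_sigma \<zeta> ` A) = carrier (cyclotomic_gal \<zeta>)"
    and S: "1 \<in> S" "A \<subseteq> S" "\<And>a b. a \<in> S \<Longrightarrow> b \<in> S \<Longrightarrow> a * b \<in> S"
    and t: "coprime t v"
  shows "\<exists>s\<in>S. [s = t] (mod v)"
proof -
  let ?G = "cyclotomic_gal \<zeta>"
  have pow: "a ^ k \<in> S" if "a \<in> S" for a k
    using that S by (induction k) auto
  have gen_S: "\<sigma> \<in> carrier ?G \<and> (\<exists>s\<in>S. \<sigma> \<zeta> = \<zeta> ^ s)" if "\<sigma> \<in> generate ?G (cyclotomic_sigma \<zeta> ` A)" for \<sigma>
    using that
  proof (induction rule: generate.induct)
    case one
    show ?case
      using S(1) cyclotomic_gal_one[of \<zeta>, THEN fun_cong, of \<zeta>]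
      by (auto simp: cyclotomic_gal_one_closed gen_in_cyclotomic_field intro!: bexI[of _ 1])
  next
    case (incl h)
    then show ?case using cyclotomic_sigma[OF v \<zeta> A] S(2) by auto
  next
    case (inv h)
    then obtain a where a: "a \<in> A" "h = cyclotomic_sigma \<zeta> a" by blast
    show ?case
      using cyclotomic_gal_inv[OF v \<zeta> A[OF a(1)] cyclotomic_sigma[OF v \<zeta> A[OF a(1)]]] a pow S(2) by blast
  next
    case (eng h1 h2)
    then obtain s1 s2 where s: "s1 \<in> S" "h1 \<zeta> = \<zeta> ^ s1" "s2 \<in> S" "h2 \<zeta> = \<zeta> ^ s2" by blast
    have "(h1 \<otimes>\<^bsub>?G\<^esub> h2) \<zeta> = \<zeta> ^ (s1 * s2)"
      using eng.IH s cyclotomic_gal_power[of h1 \<zeta> \<zeta> s2]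
      by (simp add: cyclotomic_gal_mult compose_eq gen_in_cyclotomic_field power_mult)
    then show ?case using eng.IH s S(3) cyclotomic_gal_mult_closed by blast
  qed
  have "cyclotomic_sigma \<zeta> t \<in> generate ?G (cyclotomic_sigma \<zeta> ` A)"
    unfolding gen using cyclotomic_sigma[OF v \<zeta> t] by blast
  then obtain s where "s \<in> S" "\<zeta> ^ t = \<zeta> ^ s" using gen_S cyclotomic_sigma[OF v \<zeta> t] by metis
  then show ?thesis
    using primitive_root_power_eq_iff[OF \<zeta>, of s t] v prime_gt_0_nat by auto
qed

text \<open>The Frobenius identity with explicit error term. It is stated in an arbitrary
  commutative ring because the sums are formed before passing to characteristic \<open>p\<close>;
  the multiple of \<open>p\<close> disappears only under the homomorphism.\<close>

lemma sum_power_prime: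
  fixes f :: "'i \<Rightarrow> 'r::comm_ring_1"
  assumes p: "Factorial_Ring.prime p" and A: "finite A"
  shows "\<exists>q. (\<Sum>i\<in>A. f i) ^ p = (\<Sum>i\<in>A. f i ^ p) + of_nat p * q"
  using A
proof (induction A rule: finite_induct)
  case empty
  have "p > 0" using p prime_gt_0_nat by auto
  then show ?case by (auto simp: power_0_left intro: exI[of _ 0])
next
  case (insert i A)
  then obtain q where q: "(\<Sum>i\<in>A. f i) ^ p = (\<Sum>i\<in>A. f i ^ p) + of_nat p * q" by blast
  let ?x = "f i" and ?y = "\<Sum>i\<in>A. f i"
  have p0: "p > 0" using p prime_gt_0_nat by auto
  have "(?x + ?y) ^ p = (\<Sum>k\<le>p. of_nat (p choose k) * ?x ^ k * ?y ^ (p - k))"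
    by (rule binomial_ring)
  also have "{..p} = insert 0 (insert p {0<..<p})" using p0 by auto
  also have "(\<Sum>k\<in>\<dots>. of_nat (p choose k) * ?x ^ k * ?y ^ (p - k))
      = ?y ^ p + ?x ^ p + (\<Sum>k\<in>{0<..<p}. of_nat (p choose k) * ?x ^ k * ?y ^ (p - k))"
    using p0 by (simp add: add.assoc)
  also have "(\<Sum>k\<in>{0<..<p}. of_nat (p choose k) * ?x ^ k * ?y ^ (p - k))
      = (\<Sum>k\<in>{0<..<p}. of_nat p * (of_nat ((p choose k) div p) * ?x ^ k * ?y ^ (p - k)))"
  proof (intro sum.cong refl)
    fix k assume "k \<in> {0<..<p}"
    then have "p dvd (p choose k)" using p by (intro dvd_choose_prime) auto
    then have "p choose k = p * ((p choose k) div p)" by simp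
    then have "of_nat (p choose k) = (of_nat p * of_nat ((p choose k) div p) :: 'r)"
      by (metis of_nat_mult)
    then show "of_nat (p choose k) * ?x ^ k * ?y ^ (p - k)
        = of_nat p * (of_nat ((p choose k) div p) * ?x ^ k * ?y ^ (p - k))"
      by (simp add: mult.assoc)
  qed
  also have "\<dots> = of_nat p * (\<Sum>k\<in>{0<..<p}. of_nat ((p choose k) div p) * ?x ^ k * ?y ^ (p - k))"
    by (rule sum_distrib_left[symmetric])
  finally show ?case using insert.hyps q
    by (intro exI[of _ "q + (\<Sum>k\<in>{0<..<p}. of_nat ((p choose k) div p) * ?x ^ k * ?y ^ (p - k))"])
       (simp add: algebra_simps)
qed

section \<open>Ring homomorphisms from type-class rings into record rings\<close>

text \<open>Values in the record ring \<open>R\<close> are handled as images of elements of a type-class ring, so that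
  sums are rearranged there rather than as \<^const>\<open>finsum\<close>.\<close>

locale class_ring_hom = cring R for R :: "('k, 'c) ring_scheme" (structure) and h :: "'r::comm_ring_1 \<Rightarrow> 'k" +
  assumes h_closed [simp, intro]: "h a \<in> carrier R"
    and h_add: "h (a + b) = h a \<oplus> h b"
    and h_mult: "h (a * b) = h a \<otimes> h b"
    and h_one: "h 1 = \<one>"
begin

lemma h_zero: "h 0 = \<zero>"
  using h_add[of 0 0] by (metis add.l_cancel_one' add_0 h_closed)

lemma h_uminus: "h (- a) = \<ominus> h a"
  using h_add[of "- a" a] by (simp add: h_zero minus_equality)

lemma h_diff: "h (a - b) = h a \<ominus> h b"
  using h_add[of a "- b"] by (simp add: h_uminus a_minus_def)

lemma h_power: "h (a ^ k) = h a [^] k"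
  by (induction k) (simp_all add: h_one h_mult m_comm)

lemma h_of_nat: "h (of_nat k) = [k] \<cdot> \<one>"
  by (induction k) (simp_all add: h_zero h_one h_add a_comm)

lemma h_nat_multiple: "[(k::nat)] \<cdot> h a = h (of_nat k * a)"
  by (induction k) (simp_all add: h_zero h_add distrib_right a_comm)

lemma h_sum: "h (\<Sum>i\<in>A. f i) = (\<Oplus>i\<in>A. h (f i))"
proof (cases "finite A")
  case True
  then show ?thesis by (induction A rule: finite_induct) (simp_all add: h_zero h_add Pi_def)
next
  case False
  then show ?thesis by (simp add: h_zero finsum_infinite)
qed

lemma h_sum_cong: "(\<And>i. i \<in> A \<Longrightarrow> h (f i) = h (g i)) \<Longrightarrow> h (\<Sum>i\<in>A. f i) = h (\<Sum>i\<in>A. g i)"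
  unfolding h_sum by (intro finsum_cong') auto

lemma h_eq_iff: "h a = h b \<longleftrightarrow> h (a - b) = \<zero>"
  by (simp add: h_diff)

text \<open>By Bezout, an integer prime to \<open>p\<close> with image zero would send 1 to zero.
  This allows identities between integer coefficients in K to be read back as congruences modulo
  \<open>p\<close>.\<close>

lemma h_of_int_eq_zero_iff:
  assumes p: "Factorial_Ring.prime p" and hp: "h (of_nat p) = \<zero>" and nt: "\<one> \<noteq> \<zero>"
  shows "h (of_int k) = \<zero> \<longleftrightarrow> int p dvd k"
proof
  assume k: "h (of_int k) = \<zero>"
  show "int p dvd k"
  proof (rule ccontr)
    assume "\<not> int p dvd k"
    then have "coprime (int p) k" using p by (simp add: prime_imp_coprime)
    then obtain a b where "a * int p + b * k = 1" by (metis bezout_int coprime_imp_gcd_eq_1)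
    then have "1 = (of_int (a * int p + b * k) :: 'r)" by simp
    then have "h 1 = h (of_int a * of_nat p + of_int b * of_int k)" by simp
    then show False using k hp nt by (simp add: h_one h_add h_mult)
  qed
next
  assume "int p dvd k"
  then obtain c where "k = int p * c" by blast
  then have "h (of_int k) = h (of_nat p * of_int c)" by simp
  then show "h (of_int k) = \<zero>" using hp by (simp add: h_mult)
qed

lemma h_of_int_eq_iff:
  assumes "Factorial_Ring.prime p" "h (of_nat p) = \<zero>" "\<one> \<noteq> \<zero>"
  shows "h (of_int k) = h (of_int l) \<longleftrightarrow> [k = l] (mod int p)"
  using h_of_int_eq_zero_iff[OF assms, of "k - l"] by (simp add: h_eq_iff cong_iff_dvd_diff)

end

text \<open>The evaluation Z[X] -> K at z. It supplies the type-class ring required by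
  \<open>class_ring_hom\<close> for an arbitrary record field: the root of unity in K is the image
  of X, so character sums can be formed in Z[X].\<close>

definition int_poly_eval :: "('k, 'c) ring_scheme \<Rightarrow> 'k \<Rightarrow> int poly \<Rightarrow> 'k" where
  "int_poly_eval K z q = fold_coeffs (\<lambda>a r. [a] \<cdot>\<^bsub>K\<^esub> \<one>\<^bsub>K\<^esub> \<oplus>\<^bsub>K\<^esub> z \<otimes>\<^bsub>K\<^esub> r) q \<zero>\<^bsub>K\<^esub>"

context cring
begin

lemma add_pow_zero_int: "[(0::int)] \<cdot> x = \<zero>"
  by (simp add: add_pow_def)

lemma add_pow_mult_one: "[(c * a :: int)] \<cdot> \<one> = [c] \<cdot> \<one> \<otimes> [a] \<cdot> \<one>"
  by (simp add: add_pow_ldistr_int add.int_pow_pow mult.commute)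

lemma int_poly_eval_0: "int_poly_eval R z 0 = \<zero>"
  by (simp add: int_poly_eval_def)

lemma int_poly_eval_pCons:
  "z \<in> carrier R \<Longrightarrow> int_poly_eval R z (pCons a q) = [a] \<cdot> \<one> \<oplus> z \<otimes> int_poly_eval R z q"
  by (cases "a = 0 \<and> q = 0") (auto simp: int_poly_eval_def add_pow_zero_int)

lemma int_poly_eval_closed:
  assumes "z \<in> carrier R" shows "int_poly_eval R z q \<in> carrier R"
  using assms by (induction q) (simp_all add: int_poly_eval_0 int_poly_eval_pCons)

lemma int_poly_eval_add:
  assumes z: "z \<in> carrier R"
  shows "int_poly_eval R z (q + r) = int_poly_eval R z q \<oplus> int_poly_eval R z r"
proof (induction q r rule: poly_induct2)
  case 0
  then show ?case by (simp add: int_poly_eval_0)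
next
  case (pCons a q b r)
  note [simp] = int_poly_eval_closed[OF z] z
  have "[(a + b)] \<cdot> \<one> = [a] \<cdot> \<one> \<oplus> [b] \<cdot> \<one>" by (simp add: add.int_pow_mult)
  then show ?case by (simp add: int_poly_eval_pCons pCons r_distr a_ac)
qed

lemma int_poly_eval_smult:
  assumes z: "z \<in> carrier R"
  shows "int_poly_eval R z (Polynomial.smult c q) = [c] \<cdot> \<one> \<otimes> int_poly_eval R z q"
proof (induction q)
  case 0
  then show ?case by (simp add: int_poly_eval_0)
next
  case (pCons a q)
  note [simp] = int_poly_eval_closed[OF z] z
  have "[a] \<cdot> \<one> \<in> carrier R" "[c] \<cdot> \<one> \<in> carrier R" by simp_all
  then show ?case
    by (simp add: int_poly_eval_pCons pCons.IH add_pow_mult_one r_distr m_lcomm del: add.int_pow_closed)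
qed

lemma int_poly_eval_mult:
  assumes z: "z \<in> carrier R"
  shows "int_poly_eval R z (q * r) = int_poly_eval R z q \<otimes> int_poly_eval R z r"
proof (induction q)
  case 0
  then show ?case using int_poly_eval_closed[OF z] by (simp add: int_poly_eval_0)
next
  case (pCons a q)
  note [simp] = int_poly_eval_closed[OF z] z
  show ?case
    by (simp add: int_poly_eval_pCons int_poly_eval_add int_poly_eval_smult pCons.IH
        add_pow_zero_int l_distr m_assoc)
qed

lemma int_poly_eval_X: "z \<in> carrier R \<Longrightarrow> int_poly_eval R z [:0, 1:] = z"
  by (simp add: int_poly_eval_pCons int_poly_eval_0 add_pow_zero_int)

lemma class_ring_hom_int_poly_eval:
  assumes "z \<in> carrier R" shows "class_ring_hom R (int_poly_eval R z)"
proof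
  show "int_poly_eval R z 1 = \<one>"
    using assms by (simp add: one_pCons int_poly_eval_pCons int_poly_eval_0 add_pow_zero_int)
qed (simp_all add: assms int_poly_eval_closed int_poly_eval_add int_poly_eval_mult)

end

section \<open>Sums over the group ring\<close>

lemma (in group) sum_zgr_mult:
  fixes W :: "'a \<Rightarrow> 'r::comm_ring_1"
  assumes fin: "finite (carrier G)"
  shows "(\<Sum>g\<in>carrier G. of_int (zgr_mult G A B g) * W g)
    = (\<Sum>a\<in>carrier G. \<Sum>b\<in>carrier G. of_int (A a * B b) * W (a \<otimes> b))"
proof -
  let ?P = "carrier G \<times> carrier G"
  have "(\<Sum>g\<in>carrier G. of_int (zgr_mult G A B g) * W g)
      = (\<Sum>g\<in>carrier G. \<Sum>x\<in>{x\<in>?P. fst x \<otimes> snd x = g}. of_int (A (fst x) * B (snd x)) * W (fst x \<otimes> snd x))"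
  proof (intro sum.cong refl)
    fix g assume g: "g \<in> carrier G"
    have "zgr_mult G A B g = (\<Sum>x\<in>{x\<in>?P. fst x \<otimes> snd x = g}. A (fst x) * B (snd x))"
      using g by (auto simp: zgr_mult_def case_prod_unfold intro!: sum.cong)
    then show "of_int (zgr_mult G A B g) * W g
        = (\<Sum>x\<in>{x\<in>?P. fst x \<otimes> snd x = g}. of_int (A (fst x) * B (snd x)) * W (fst x \<otimes> snd x))"
      by (simp add: sum_distrib_right)
  qed
  also have "\<dots> = (\<Sum>x\<in>?P. of_int (A (fst x) * B (snd x)) * W (fst x \<otimes> snd x))"
    by (rule sum.group) (use fin in auto)
  also have "\<dots> = (\<Sum>a\<in>carrier G. \<Sum>b\<in>carrier G. of_int (A a * B b) * W (a \<otimes> b))"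
    by (simp add: sum.cartesian_product case_prod_unfold)
  finally show ?thesis .
qed

lemma (in group) sum_zgr_power_map:
  fixes W :: "'a \<Rightarrow> 'r::comm_ring_1"
  assumes fin: "finite (carrier G)"
  shows "(\<Sum>g\<in>carrier G. of_int (zgr_power_map G t A g) * W g)
    = (\<Sum>a\<in>carrier G. of_int (A a) * W (a [^] t))"
proof -
  have "(\<Sum>g\<in>carrier G. of_int (zgr_power_map G t A g) * W g)
      = (\<Sum>g\<in>carrier G. \<Sum>a\<in>{a\<in>carrier G. a [^] t = g}. of_int (A a) * W (a [^] t))"
    by (intro sum.cong refl) (simp add: zgr_power_map_def sum_distrib_right)
  also have "\<dots> = (\<Sum>a\<in>carrier G. of_int (A a) * W (a [^] t))"
    by (rule sum.group) (use fin in auto)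
  finally show ?thesis .
qed

text \<open>The group ring equation paired with a weight W. Multiplicativity of W is not assumed,
  since z^(t * e a) becomes a character only after applying h; the double sum is therefore left
  unfactored. The weight 1 gives the augmentation.\<close>

lemma (in group) sum_of_square_equation:
  fixes W :: "'a \<Rightarrow> 'r::comm_ring_1"
  assumes fin: "finite (carrier G)"
    and eq: "zgr_mult G T T =
           zgr_add G
             (zgr_diff G (zgr_mult G (zgr_of_int G 2) (zgr_all G)) (zgr_power_map G 2 T))
             (zgr_of_int G (2 * int n))"
  shows "(\<Sum>a\<in>carrier G. \<Sum>b\<in>carrier G. of_int (T a * T b) * W (a \<otimes> b))
    = 2 * (\<Sum>a\<in>carrier G. W a) - (\<Sum>a\<in>carrier G. of_int (T a) * W (a \<otimes> a)) + of_nat (2 * n) * W \<one>"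
proof -
  have one: "(\<Sum>a\<in>carrier G. of_int (if a = \<one> then c else 0) * V a) = of_int c * V \<one>"
    for c and V :: "'a \<Rightarrow> 'r"
    using fin by (subst sum.mono_neutral_cong_right[of _ "{\<one>}"]) auto
  have sq: "a [^] (2::int) = a \<otimes> a" if "a \<in> carrier G" for a
    using that int_pow_mult[of a 1 1] by simp
  have "(\<Sum>a\<in>carrier G. \<Sum>b\<in>carrier G. of_int (T a * T b) * W (a \<otimes> b))
      = (\<Sum>g\<in>carrier G. of_int (zgr_mult G T T g) * W g)"
    by (rule sum_zgr_mult[OF fin, symmetric])
  also have "\<dots> = (\<Sum>g\<in>carrier G. of_int (zgr_mult G (zgr_of_int G 2) (zgr_all G) g) * W g)
      - (\<Sum>g\<in>carrier G. of_int (zgr_power_map G 2 T g) * W g)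
      + (\<Sum>g\<in>carrier G. of_int (zgr_of_int G (2 * int n) g) * W g)"
    unfolding eq by (simp add: zgr_add_def zgr_diff_def sum.distrib sum_subtractf algebra_simps)
  also have "(\<Sum>g\<in>carrier G. of_int (zgr_power_map G 2 T g) * W g) = (\<Sum>a\<in>carrier G. of_int (T a) * W (a \<otimes> a))"
    unfolding sum_zgr_power_map[OF fin] by (intro sum.cong refl) (simp add: sq)
  also have "(\<Sum>g\<in>carrier G. of_int (zgr_of_int G (2 * int n) g) * W g) = of_nat (2 * n) * W \<one>"
    using one[of "2 * int n" W] by (simp add: zgr_of_int_def)
  also have "(\<Sum>g\<in>carrier G. of_int (zgr_mult G (zgr_of_int G 2) (zgr_all G) g) * W g)
      = (\<Sum>a\<in>carrier G. of_int (if a = \<one> then 2 else 0) * (\<Sum>b\<in>carrier G. W (a \<otimes> b)))"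
    unfolding sum_zgr_mult[OF fin] by (simp add: zgr_of_int_def zgr_all_def sum_distrib_left)
  also have "\<dots> = 2 * (\<Sum>a\<in>carrier G. W a)" unfolding one by simp
  finally show ?thesis .
qed

lemma (in group) sum_symmetric:
  fixes W :: "'a \<Rightarrow> 'r::comm_ring_1"
  assumes fin: "finite (carrier G)" and "T = zgr_power_map G (- 1) T"
  shows "(\<Sum>a\<in>carrier G. of_int (T a) * W a) = (\<Sum>a\<in>carrier G. of_int (T a) * W (inv a))"
  using sum_zgr_power_map[OF fin, of "- 1" T W] assms(2) by (simp add: int_pow_neg)

section \<open>Prime-index subgroups, powers of 2 and p, and roots of unity\<close>

text \<open>G/H has prime order, so any coset C other than H generates it. The grading
  \<open>e\<close> is the discrete logarithm to base C of the coset of a, and its fibres are exactly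
  the cosets of H.\<close>

lemma (in comm_group) exists_cyclic_grading:
  assumes fin: "finite (carrier G)" and H: "subgroup H G"
    and card: "card (rcosets H) = v" and v: "Factorial_Ring.prime v"
  obtains e :: "'a \<Rightarrow> nat" where "\<And>a. a \<in> carrier G \<Longrightarrow> e a < v"
    "\<And>a b. a \<in> carrier G \<Longrightarrow> b \<in> carrier G \<Longrightarrow> [e (a \<otimes> b) = e a + e b] (mod v)"
    "\<And>i. i < v \<Longrightarrow> card {a \<in> carrier G. e a = i} = card H"
proof -
  interpret N: normal H G using subgroup_imp_normal[OF H] .
  define Q where "Q = G Mod H"
  interpret Q: group Q unfolding Q_def by (rule N.factorgroup_is_group)
  have v1: "v > 1" using v prime_gt_1_nat by auto
  have car: "carrier Q = rcosets H" and one: "\<one>\<^bsub>Q\<^esub> = H" by (simp_all add: Q_def FactGroup_def)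
  have cardQ: "card (carrier Q) = v" using card car by simp
  then have finQ: "finite (carrier Q)" using v1 by (metis card.infinite not_one_less_zero)
  have "carrier Q \<noteq> {\<one>\<^bsub>Q\<^esub>}" using cardQ v1 by auto
  then obtain C where C: "C \<in> carrier Q" "C \<noteq> \<one>\<^bsub>Q\<^esub>" using Q.one_closed by blast
  have "Q.ord C dvd v" using Q.ord_dvd_group_order[OF C(1)] cardQ by (simp add: Coset.order_def)
  moreover have "Q.ord C \<noteq> 1" using C Q.ord_eq_1 by blast
  ultimately have ordC: "Q.ord C = v" using v by (auto simp: prime_nat_iff)
  have inj: "inj_on (\<lambda>i. C [^]\<^bsub>Q\<^esub> i) {..<v}"
  proof -
    have "{..<v} = {0..v - 1}" using v1 by auto
    then show ?thesis using Q.ord_inj[OF C(1)] unfolding ordC by simp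
  qed
  have surj: "(\<lambda>i. C [^]\<^bsub>Q\<^esub> i) ` {..<v} = carrier Q"
  proof (rule card_subset_eq[OF finQ])
    show "(\<lambda>i. C [^]\<^bsub>Q\<^esub> i) ` {..<v} \<subseteq> carrier Q" using C(1) by auto
    show "card ((\<lambda>i. C [^]\<^bsub>Q\<^esub> i) ` {..<v}) = card (carrier Q)"
      using cardQ by (simp add: card_image[OF inj])
  qed
  have coset: "H #> a \<in> carrier Q" if "a \<in> carrier G" for a
    using that rcosetsI[OF N.subset] car by simp
  define e where "e = (\<lambda>a. the_inv_into {..<v} (\<lambda>i. C [^]\<^bsub>Q\<^esub> i) (H #> a))"
  have e: "e a < v" "C [^]\<^bsub>Q\<^esub> e a = H #> a" if "a \<in> carrier G" for a
  proof -
    have mem: "H #> a \<in> (\<lambda>i. C [^]\<^bsub>Q\<^esub> i) ` {..<v}" using coset[OF that] surj by simp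
    show "e a < v" using the_inv_into_into[OF inj mem subset_refl] unfolding e_def by simp
    show "C [^]\<^bsub>Q\<^esub> e a = H #> a" using f_the_inv_into_f[OF inj mem] unfolding e_def .
  qed
  have pow_eq: "C [^]\<^bsub>Q\<^esub> i = C [^]\<^bsub>Q\<^esub> j \<Longrightarrow> [i = j] (mod v)" for i j
  proof -
    assume "C [^]\<^bsub>Q\<^esub> i = C [^]\<^bsub>Q\<^esub> j"
    then have "int v dvd int j - int i"
      using Q.int_pow_eq[OF C(1), of "int i" "int j"] ordC by (simp add: int_pow_int)
    then show ?thesis by (metis cong_iff_dvd_diff cong_int_iff cong_sym)
  qed
  show thesis
  proof (rule that[of e])
    show "e a < v" if "a \<in> carrier G" for a using e that by blast
    show "[e (a \<otimes> b) = e a + e b] (mod v)" if ab: "a \<in> carrier G" "b \<in> carrier G" for a b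
    proof (rule pow_eq)
      have "C [^]\<^bsub>Q\<^esub> (e a + e b) = (H #> a) \<otimes>\<^bsub>Q\<^esub> (H #> b)"
        using e ab C(1) by (simp flip: Q.nat_pow_mult)
      also have "\<dots> = H #> (a \<otimes> b)" using N.rcos_sum ab by (simp add: Q_def FactGroup_def)
      also have "\<dots> = C [^]\<^bsub>Q\<^esub> e (a \<otimes> b)" using e ab by simp
      finally show "C [^]\<^bsub>Q\<^esub> e (a \<otimes> b) = C [^]\<^bsub>Q\<^esub> (e a + e b)" by simp
    qed
    show "card {a \<in> carrier G. e a = i} = card H" if i: "i < v" for i
    proof -
      have "C [^]\<^bsub>Q\<^esub> i \<in> rcosets H" using C(1) car Q.nat_pow_closed by metis
      then obtain c where c: "c \<in> carrier G" "C [^]\<^bsub>Q\<^esub> i = H #> c" by (auto simp: RCOSETS_def)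
      have "{a \<in> carrier G. e a = i} = H #> c"
      proof (intro equalityI subsetI)
        fix a assume "a \<in> {a \<in> carrier G. e a = i}"
        then have "H #> a = H #> c" "a \<in> carrier G" using e(2) c by auto
        then show "a \<in> H #> c" using rcos_self[OF _ H] by blast
      next
        fix a assume a: "a \<in> H #> c"
        then have aG: "a \<in> carrier G" using c r_coset_subset_G[OF N.subset] by blast
        have "H #> c = H #> a" by (rule repr_independence[OF a c(1) H])
        then have "C [^]\<^bsub>Q\<^esub> e a = C [^]\<^bsub>Q\<^esub> i" using e(2)[OF aG] c by simp
        then have "e a = i" using inj e(1)[OF aG] i by (auto simp: inj_on_def)
        then show "a \<in> {a \<in> carrier G. e a = i}" using aG by simp
      qed
      then show ?thesis using card_cosets_equal[OF _ N.subset] rcosetsI[OF N.subset c(1)] by (metis card_cosets_equal N.subset bij_betw_same_card)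
    qed
  qed
qed

section \<open>Enumerations of the nonzero residues modulo v\<close>

lemma bij_betw_if_card_eq:
  assumes "finite A" "f ` A = B" "card A = card B"
  shows "bij_betw f A B"
  using assms by (simp add: bij_betw_def eq_card_imp_inj_on)

lemma nonzero_residue_iff_coprime:
  assumes "Factorial_Ring.prime (v::nat)" "t < v"
  shows "t \<in> {1..<v} \<longleftrightarrow> coprime t v"
proof
  assume "t \<in> {1..<v}"
  then have "\<not> v dvd t" by (auto dest: dvd_imp_le)
  then show "coprime t v" using assms(1) prime_imp_coprime coprime_commute by blast
next
  assume "coprime t v"
  then show "t \<in> {1..<v}" using assms prime_gt_1_nat[OF assms(1)] by (cases "t = 0") auto
qed

lemma bij_betw_powers_of_2:
  assumes v: "Factorial_Ring.prime (v::nat)" "odd v"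
    and gen: "\<And>t. coprime t v \<Longrightarrow> \<exists>i. [2 ^ i = t] (mod v)"
  shows "bij_betw (\<lambda>i. 2 ^ i mod v) {..<v - 1} {1..<v}"
proof (rule bij_betw_if_card_eq)
  have v1: "v > 1" using v prime_gt_1_nat by auto
  have "[2 ^ (v - 1) = 1] (mod v)" using fermat_theorem[OF v(1), of 2] v(2) v1
    by (metis coprime_right_2_iff_odd coprime_absorb_left nat_dvd_1_iff_1 less_irrefl)
  then have red: "[2 ^ i = 2 ^ (i mod (v - 1))] (mod v)" for i
  proof -
    have "[(2 ^ (v - 1)) ^ (i div (v - 1)) * 2 ^ (i mod (v - 1)) = 1 ^ (i div (v - 1)) * 2 ^ (i mod (v - 1))] (mod v)"
      by (intro cong_mult cong_pow cong_refl) fact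
    then show ?thesis by (simp flip: power_mult power_add)
  qed
  have "2 ^ i mod v \<in> {1..<v}" for i
    using nonzero_residue_iff_coprime[OF v(1), of "2 ^ i mod v"] v(2) v1 by simp
  moreover have "t \<in> (\<lambda>i. 2 ^ i mod v) ` {..<v - 1}" if t: "t \<in> {1..<v}" for t
  proof -
    from t have "coprime t v" using nonzero_residue_iff_coprime[OF v(1), of t] by simp
    then obtain i where "[2 ^ i = t] (mod v)" using gen by blast
    then have "[2 ^ (i mod (v - 1)) = t] (mod v)" using red cong_trans cong_sym by blast
    then have "2 ^ (i mod (v - 1)) mod v = t" using t by (simp add: cong_def)
    moreover have "i mod (v - 1) < v - 1" using v1 by simp
    ultimately show ?thesis by (metis image_eqI lessThan_iff)
  qed
  ultimately show "(\<lambda>i. 2 ^ i mod v) ` {..<v - 1} = {1..<v}" by blast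
qed simp_all

text \<open>The residues form the cosets of the subgroup generated by p, with representatives the
  powers of 2 below \<open>c\<close>, the order of 2 modulo that subgroup. Counting gives c * f = v
  - 1, which identifies \<open>c\<close> with \<open>d\<close>.\<close>

lemma bij_betw_powers_of_2_and_p:
  assumes v: "Factorial_Ring.prime (v::nat)" "odd v" and p: "coprime p v"
    and gen: "\<And>t. coprime t v \<Longrightarrow> \<exists>i j. [2 ^ i * p ^ j = t] (mod v)"
    and f: "f = ord v p" and d: "d = (v - 1) div f"
  shows "bij_betw (\<lambda>(i, j). 2 ^ i * p ^ j mod v) ({..<d} \<times> {..<f}) {1..<v}"
proof -
  have v1: "v > 1" using v prime_gt_1_nat by auto
  have f0: "f > 0" using p f by (simp add: coprime_commute)
  have pf: "[p ^ f = 1] (mod v)" unfolding f by (rule ord)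
  have p_red: "[p ^ j = p ^ (j mod f)] (mod v)" for j
  proof -
    have "[(p ^ f) ^ (j div f) * p ^ (j mod f) = 1 ^ (j div f) * p ^ (j mod f)] (mod v)"
      by (intro cong_mult cong_pow cong_refl pf)
    then show ?thesis by (simp flip: power_mult power_add)
  qed
  define P where "P = (\<lambda>i. \<exists>j. [2 ^ i = p ^ j] (mod v))"
  define c where "c = (LEAST i. i > 0 \<and> P i)"
  have "[2 ^ (v - 1) = 1] (mod v)" using fermat_theorem[OF v(1), of 2] v(2) v1
    by (metis coprime_right_2_iff_odd coprime_absorb_left nat_dvd_1_iff_1 less_irrefl)
  then have "P (v - 1)" unfolding P_def by (intro exI[of _ 0]) simp
  then have c: "c > 0" "P c" using LeastI[of "\<lambda>i. i > 0 \<and> P i" "v - 1"] v1 unfolding c_def by auto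
  have c_min: "\<not> P i" if "i > 0" "i < c" for i using that not_less_Least unfolding c_def by blast
  obtain k where k: "[2 ^ c = p ^ k] (mod v)" using c(2) unfolding P_def by blast
  have red: "\<exists>i' < c. \<exists>j' < f. [2 ^ i * p ^ j = 2 ^ i' * p ^ j'] (mod v)" for i j
  proof -
    have "[(2 ^ c) ^ (i div c) * 2 ^ (i mod c) * p ^ j = (p ^ k) ^ (i div c) * 2 ^ (i mod c) * p ^ j] (mod v)"
      by (intro cong_mult cong_pow cong_refl k)
    moreover have "(2 ^ c) ^ (i div c) * 2 ^ (i mod c) * p ^ j = 2 ^ i * p ^ j"
      by (simp flip: power_mult power_add)
    moreover have "(p ^ k) ^ (i div c) * 2 ^ (i mod c) * p ^ j = 2 ^ (i mod c) * p ^ (k * (i div c) + j)"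
      by (simp add: power_add power_mult)
    ultimately have "[2 ^ i * p ^ j = 2 ^ (i mod c) * p ^ (k * (i div c) + j)] (mod v)" by argo
    moreover have "[2 ^ (i mod c) * p ^ (k * (i div c) + j) = 2 ^ (i mod c) * p ^ ((k * (i div c) + j) mod f)] (mod v)"
      by (intro cong_mult cong_refl p_red)
    ultimately have "[2 ^ i * p ^ j = 2 ^ (i mod c) * p ^ ((k * (i div c) + j) mod f)] (mod v)"
      by (rule cong_trans)
    moreover have "i mod c < c" "(k * (i div c) + j) mod f < f" using c f0 by simp_all
    ultimately show ?thesis by blast
  qed
  let ?r = "\<lambda>(i, j). 2 ^ i * p ^ j mod v"
  have img: "?r ` ({..<c} \<times> {..<f}) = {1..<v}"
  proof
    have "2 ^ i * p ^ j mod v \<in> {1..<v}" for i j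
      using nonzero_residue_iff_coprime[OF v(1), of "2 ^ i * p ^ j mod v"] v(2) v1 p
      by (simp add: coprime_left_2_iff_odd)
    then show "?r ` ({..<c} \<times> {..<f}) \<subseteq> {1..<v}" by auto
    show "{1..<v} \<subseteq> ?r ` ({..<c} \<times> {..<f})"
    proof
      fix t assume t: "t \<in> {1..<v}"
      then have "coprime t v" using nonzero_residue_iff_coprime[OF v(1), of t] by simp
      then obtain i j where "[2 ^ i * p ^ j = t] (mod v)" using gen by blast
      moreover obtain i' j' where ij: "i' < c" "j' < f" "[2 ^ i * p ^ j = 2 ^ i' * p ^ j'] (mod v)"
        using red by blast
      ultimately have "[2 ^ i' * p ^ j' = t] (mod v)" using cong_trans cong_sym by blast
      then have "2 ^ i' * p ^ j' mod v = t" using t by (simp add: cong_def)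
      then show "t \<in> ?r ` ({..<c} \<times> {..<f})" using ij by force
    qed
  qed
  have key: "i = i' \<and> j = j'" if ij: "i < c" "j < f" "i' < c" "j' < f" "i \<le> i'"
    and eq: "[2 ^ i * p ^ j = 2 ^ i' * p ^ j'] (mod v)" for i j i' j'
  proof -
    have 2: "coprime (2 ^ i) v" using v(2) by (simp add: coprime_left_2_iff_odd)
    have "2 ^ i' = 2 ^ i * (2 ^ (i' - i) :: nat)" using ij by (simp flip: power_add)
    then have "[2 ^ i * p ^ j = 2 ^ i * (2 ^ (i' - i) * p ^ j')] (mod v)" using eq by (simp add: mult.assoc)
    then have 1: "[p ^ j = 2 ^ (i' - i) * p ^ j'] (mod v)" using cong_mult_lcancel_nat[OF 2] by blast
    \<comment> \<open>Multiplying by p^(f - j') completes p^j' to p^f = 1, so 2^(i' - i) is a power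
      of p; minimality of \<open>c\<close> then forces i' = i.\<close>
    have "[2 ^ (i' - i) * p ^ j' * p ^ (f - j') = p ^ j * p ^ (f - j')] (mod v)"
      by (intro cong_mult cong_refl cong_sym[OF 1])
    then have "[2 ^ (i' - i) * p ^ f = p ^ (j + (f - j'))] (mod v)"
      using ij by (simp add: mult.assoc flip: power_add)
    moreover have "[2 ^ (i' - i) * p ^ f = 2 ^ (i' - i) * 1] (mod v)" by (intro cong_mult cong_refl pf)
    ultimately have "P (i' - i)" unfolding P_def using cong_trans cong_sym by (metis mult_1_right)
    then have i: "i' = i" using c_min[of "i' - i"] ij by (cases "i' = i") auto
    then have "[p ^ j = p ^ j'] (mod v)" using 1 by simp
    then have "[j = j'] (mod f)" using order_divides_expdiff[of v p j j'] p f by (simp add: coprime_commute)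
    then show ?thesis using i ij by (simp add: cong_def)
  qed
  have inj: "inj_on ?r ({..<c} \<times> {..<f})"
  proof (rule inj_onI, clarify)
    fix i j i' j' assume ij: "i < c" "j < f" "i' < c" "j' < f"
      and "2 ^ i * p ^ j mod v = 2 ^ i' * p ^ j' mod v"
    then have "[2 ^ i * p ^ j = 2 ^ i' * p ^ j'] (mod v)" by (simp add: cong_def)
    then show "i = i' \<and> j = j'"
      using key[of i j i' j'] key[of i' j' i j] ij cong_sym by (cases "i \<le> i'") auto
  qed
  have "c * f = v - 1" using card_image[OF inj] img by simp
  then have "c = d" using d f0 by (metis nonzero_mult_div_cancel_right less_irrefl)
  then show ?thesis using inj img by (simp add: bij_betw_def)
qed

section \<open>Roots of unity in characteristic p\<close>

lemma (in domain) nat_multiple_one_nonzero: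
  assumes p: "Factorial_Ring.prime p" and char: "[(p::nat)] \<cdot> \<one> = \<zero>" and v: "\<not> p dvd v"
  shows "[(v::nat)] \<cdot> \<one> \<noteq> \<zero>"
proof -
  \<comment> \<open>Evaluation at zero merely provides a homomorphism from a type-class ring, so
    that the kernel of the integers in R can be read off.\<close>
  interpret class_ring_hom R "int_poly_eval R \<zero>" by (rule class_ring_hom_int_poly_eval) simp
  have "int_poly_eval R \<zero> (of_int (int v)) \<noteq> \<zero>"
    using v char by (subst h_of_int_eq_zero_iff[OF p]) (simp_all add: h_of_nat)
  then show ?thesis by (simp add: h_of_nat)
qed

text \<open>In the coefficient-list representation \<open>replicate k \<one>\<close> is 1 + X + ...
  + X^(k-1), so this is the telescoping of a geometric sum.\<close>

lemma (in cring) geometric_eval: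
  assumes "x \<in> carrier R"
  shows "(x \<ominus> \<one>) \<otimes> eval (replicate k \<one>) x = x [^] k \<ominus> \<one>"
proof (induction k)
  case 0
  then show ?case using assms by (simp add: a_minus_def r_neg)
next
  case (Suc k)
  have c: "eval (replicate k \<one>) x \<in> carrier R" using assms by (intro eval_in_carrier) auto
  have "eval (replicate (Suc k) \<one>) x = x [^] k \<oplus> eval (replicate k \<one>) x" using assms by simp
  then have "(x \<ominus> \<one>) \<otimes> eval (replicate (Suc k) \<one>) x = (x \<ominus> \<one>) \<otimes> x [^] k \<oplus> (x [^] k \<ominus> \<one>)"
    using assms c Suc by (simp add: r_distr)
  also have "\<dots> = x [^] k \<otimes> x \<ominus> \<one>"
  proof -
    have "(x \<ominus> \<one>) \<otimes> y \<oplus> (y \<ominus> \<one>) = y \<otimes> x \<ominus> \<one>" if "y \<in> carrier R" for y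
      using that assms by algebra
    then show ?thesis using assms by simp
  qed
  finally show ?case by simp
qed

text \<open>A root of 1 + X + ... + X^(v-1) is a v-th root of unity, and it differs from 1 because
  the value of the polynomial at 1 is v, which is nonzero in L.\<close>

lemma (in algebraically_closed) exists_root_of_unity:
  assumes v: "v > 1" and nz: "[(v::nat)] \<cdot>\<^bsub>L\<^esub> \<one>\<^bsub>L\<^esub> \<noteq> \<zero>\<^bsub>L\<^esub>"
  obtains z where "z \<in> carrier L" "z [^]\<^bsub>L\<^esub> v = \<one>\<^bsub>L\<^esub>" "z \<noteq> \<one>\<^bsub>L\<^esub>"
proof -
  let ?P = "replicate v \<one>\<^bsub>L\<^esub>"
  have ne: "?P \<noteq> []" using v by simp
  have P: "?P \<in> carrier (poly_ring L)"
    using ne v unfolding univ_poly_carrier[symmetric] polynomial_def by (auto simp: hd_replicate)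
  have "size (roots ?P) = v - 1" using roots_over_carrier[OF P] by (simp add: splitted_def)
  then have "roots ?P \<noteq> {#}" using v by auto
  then obtain z where "z \<in># roots ?P" by blast
  then have "is_root ?P z" using roots_mem_iff_is_root[OF P] by simp
  then have z: "z \<in> carrier L" "eval ?P z = \<zero>\<^bsub>L\<^esub>" by (auto simp: is_root_def)
  have "z [^]\<^bsub>L\<^esub> v \<ominus>\<^bsub>L\<^esub> \<one>\<^bsub>L\<^esub> = \<zero>\<^bsub>L\<^esub>" using geometric_eval[OF z(1), of v] z by simp
  then have "z [^]\<^bsub>L\<^esub> v = \<one>\<^bsub>L\<^esub>" using z(1) by simp
  moreover have "eval (replicate k \<one>\<^bsub>L\<^esub>) \<one>\<^bsub>L\<^esub> = [k] \<cdot>\<^bsub>L\<^esub> \<one>\<^bsub>L\<^esub>" for k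
    by (induction k) (simp_all add: a_comm)
  then have "z \<noteq> \<one>\<^bsub>L\<^esub>" using nz z(2) by metis
  ultimately show thesis using that z(1) by blast
qed

text \<open>An algebraic closure of Z/p on a concrete type. It serves part (i), whose truth cannot
  depend on whether the type variable for K is inhabited by a suitable field.\<close>

lemma exists_field_with_root_of_unity:
  assumes p: "Factorial_Ring.prime p" and v: "v > 1" "\<not> p dvd v"
  obtains L :: "((int list \<times> nat) multiset \<Rightarrow> int) ring" and z
  where "field L" "[(p::nat)] \<cdot>\<^bsub>L\<^esub> \<one>\<^bsub>L\<^esub> = \<zero>\<^bsub>L\<^esub>" "z \<in> carrier L" "z [^]\<^bsub>L\<^esub> v = \<one>\<^bsub>L\<^esub>" "z \<noteq> \<one>\<^bsub>L\<^esub>"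
proof -
  define R where "R = residue_ring (int p)"
  interpret R: residues_prime p R by unfold_locales (use p R_def in auto)
  obtain L :: "((int list \<times> nat) multiset \<Rightarrow> int) ring" where L: "algebraic_closure L (R.indexed_const ` carrier R)" and hom: "R.indexed_const \<in> ring_hom R L"
    using R.exists_closure by blast
  interpret L: algebraic_closure L "R.indexed_const ` carrier R" by (rule L)
  interpret I: ring_hom_ring R L "R.indexed_const"
    by (rule ring_hom_ringI2) (use hom R.ring_axioms L.ring_axioms in auto)
  have multR: "[k] \<cdot>\<^bsub>R\<^esub> \<one>\<^bsub>R\<^esub> = int k mod int p" for k :: nat
    by (induction k) (simp_all add: R.zero_cong R.one_cong R.add_cong add.commute)
  have "R.indexed_const ([k] \<cdot>\<^bsub>R\<^esub> \<one>\<^bsub>R\<^esub>) = [k] \<cdot>\<^bsub>L\<^esub> \<one>\<^bsub>L\<^esub>" for k :: nat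
    by (induction k) (simp_all add: I.hom_add)
  from this[of p] have char: "[p] \<cdot>\<^bsub>L\<^esub> \<one>\<^bsub>L\<^esub> = \<zero>\<^bsub>L\<^esub>"
    using multR[of p] R.zero_cong by (metis I.hom_zero mod_self)
  obtain z where "z \<in> carrier L" "z [^]\<^bsub>L\<^esub> v = \<one>\<^bsub>L\<^esub>" "z \<noteq> \<one>\<^bsub>L\<^esub>"
    using L.exists_root_of_unity[OF v(1)] L.nat_multiple_one_nonzero[OF p char v(2)] by blast
  then show thesis using that L.field_axioms char by blast
qed

text \<open>The additive order p^f kills 1, and p^f times 1 is the f-th power of p times 1, so the
  latter vanishes in a field. For the root, a generator of the cyclic multiplicative group is raised
  to the power (p^f - 1)/v.\<close>

lemma (in field) finite_field_char_and_root:
  assumes card: "card (carrier R) = p ^ f" and p: "Factorial_Ring.prime p" and f: "f > 0"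
  shows "[(p::nat)] \<cdot> \<one> = \<zero>"
    and "v > 1 \<Longrightarrow> v dvd p ^ f - 1 \<Longrightarrow> \<exists>z\<in>carrier R. z [^] v = \<one> \<and> z \<noteq> \<one>"
proof -
  have p1: "p > 1" using p prime_gt_1_nat by auto
  have pf: "p ^ f > 1" using p1 f by (metis one_less_power)
  have fin: "finite (carrier R)" using card pf by (metis card.infinite not_one_less_zero)
  have "[(p ^ f)] \<cdot> \<one> = \<zero>"
    using add.pow_order_eq_1[of \<one>] card by (simp add: Coset.order_def)
  moreover have "[(p ^ k)] \<cdot> \<one> = ([p] \<cdot> \<one>) [^] k" for k
  proof (induction k)
    case (Suc k)
    have "[(p ^ Suc k)] \<cdot> \<one> = [p] \<cdot> ([(p ^ k)] \<cdot> \<one>)" by (simp add: add.nat_pow_pow mult.commute)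
    also have "\<dots> = [p] \<cdot> \<one> \<otimes> [(p ^ k)] \<cdot> \<one>" by (simp add: add_pow_ldistr)
    finally show ?case using Suc by (simp add: m_comm)
  qed simp
  ultimately have pow0: "([p] \<cdot> \<one>) [^] f = \<zero>" by simp
  interpret M: group "Multiplicative_Group.mult_of R" by (rule field_mult_group)
  show "[p] \<cdot> \<one> = \<zero>"
  proof (rule ccontr)
    assume "[p] \<cdot> \<one> \<noteq> \<zero>"
    then have "[p] \<cdot> \<one> \<in> carrier (Multiplicative_Group.mult_of R)" by simp
    from M.nat_pow_closed[OF this, of f] show False using pow0 by (simp add: Multiplicative_Group.nat_pow_mult_of)
  qed
  assume v: "v > 1" "v dvd p ^ f - 1"
  obtain a where a: "a \<in> carrier (Multiplicative_Group.mult_of R)" "carrier (Multiplicative_Group.mult_of R) = {a [^] i | i :: nat. i \<in> UNIV}"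
    using finite_field_mult_group_has_gen[OF fin] by blast
  have "p ^ f - 1 = card (carrier (Multiplicative_Group.mult_of R))" using card fin by simp
  also have "carrier (Multiplicative_Group.mult_of R) = generate (Multiplicative_Group.mult_of R) {a}"
    using M.generate_pow_nat[OF a(1)] a(2) M.ord_ge_1[OF finite_mult_of[OF fin] a(1)]
    by (simp add: Multiplicative_Group.nat_pow_mult_of)
  also have "card \<dots> = M.ord a" using M.generate_pow_card[OF a(1)] by simp
  finally have ord: "M.ord a = p ^ f - 1" by simp
  obtain q where q: "p ^ f - 1 = v * q" using v(2) by blast
  have "q > 0" using q pf by (cases "q = 0") auto
  have aR: "a \<in> carrier R" using a(1) by simp
  have "(a [^] q) [^] v = \<one>"
    using M.pow_ord_eq_1[OF a(1)] aR unfolding ord q by (simp add: Multiplicative_Group.nat_pow_mult_of nat_pow_pow mult.commute)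
  moreover have "a [^] q \<noteq> \<one>"
  proof
    assume "a [^] q = \<one>"
    then have "p ^ f - 1 dvd q" using M.pow_eq_id[OF a(1), of q] unfolding ord by (simp add: Multiplicative_Group.nat_pow_mult_of)
    then have "v * q \<le> q" using \<open>q > 0\<close> q by (auto dest: dvd_imp_le)
    then show False using v(1) \<open>q > 0\<close> by simp
  qed
  ultimately show "\<exists>z\<in>carrier R. z [^] v = \<one> \<and> z \<noteq> \<one>" using aR by blast
qed

text \<open>The q - 1 nonzero elements of L already satisfy y^(q-1) = 1, and that equation has at
  most q - 1 solutions in the whole field.\<close>

lemma (in field) subfield_mem_if_power_eq_1:
  assumes fin: "finite (carrier R)" and L: "subfield L R" and card: "card L = q" and q: "q > 1"
    and x: "x \<in> carrier R" "x [^] (q - 1) = \<one>"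
  shows "x \<in> L"
proof -
  let ?A = "{x \<in> carrier R. x [^] (q - 1) = \<one>}"
  have LR: "L \<subseteq> carrier R" using subfieldE(3)[OF L] .
  have finL: "finite L" using LR fin finite_subset by blast
  interpret F: field "R\<lparr>carrier := L\<rparr>" using subfield_iff(2)[OF L] .
  interpret M: group "Multiplicative_Group.mult_of (R\<lparr>carrier := L\<rparr>)" by (rule F.field_mult_group)
  have ordM: "Coset.order (Multiplicative_Group.mult_of (R\<lparr>carrier := L\<rparr>)) = q - 1"
    using finL card F.zero_closed by (simp add: Coset.order_def)
  have "L - {\<zero>} \<subseteq> ?A"
  proof
    fix y assume y: "y \<in> L - {\<zero>}"
    then have "y [^]\<^bsub>Multiplicative_Group.mult_of (R\<lparr>carrier := L\<rparr>)\<^esub> (q - 1) = \<one>"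
      using M.pow_order_eq_1[of y] unfolding ordM by simp
    then have "y [^]\<^bsub>R\<lparr>carrier := L\<rparr>\<^esub> (q - 1) = \<one>" by (simp add: Multiplicative_Group.nat_pow_mult_of)
    then show "y \<in> ?A" using y LR by (auto simp: nat_pow_consistent[symmetric])
  qed
  moreover have "card ?A \<le> card (L - {\<zero>})"
    using num_roots_le_deg[OF fin, of "q - 1"] q card finL F.zero_closed by simp
  moreover have "finite ?A" using fin by simp
  ultimately have "L - {\<zero>} = ?A" by (simp add: card_seteq)
  then show ?thesis using x by blast
qed

section \<open>Solutions of the group ring equation modulo p\<close>

lemma divisor_of_order_coprime:
  fixes n v p m :: nat
  assumes "m * v = 2 * n\<^sup>2 + 2 * n + 1"
  shows "odd v" and "Factorial_Ring.prime p \<Longrightarrow> p dvd n \<Longrightarrow> coprime p v"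
proof -
  have "odd (m * v)" unfolding assms by simp
  then show "odd v" by simp
  assume p: "Factorial_Ring.prime p" "p dvd n"
  have "\<not> p dvd v"
  proof
    assume "p dvd v"
    then have "p dvd m * v" by simp
    moreover have "p dvd 2 * n\<^sup>2 + 2 * n" using p(2) by (simp add: power2_eq_square)
    ultimately have "p dvd 1" unfolding assms using dvd_add_right_iff by blast
    then show False using p(1) by simp
  qed
  then show "coprime p v" using p(1) by (simp add: prime_imp_coprime)
qed

text \<open>The map \<open>e\<close> encodes the projection of \<open>G\<close> onto $G/H \cong \mathbf{Z}/v$.\<close>

locale graded_solution =
  fixes G :: "('g, 'b) monoid_scheme" and T :: "'g \<Rightarrow> int" and e :: "'g \<Rightarrow> nat" and n v p m :: nat
  assumes group_G: "group G"
    and fin: "finite (carrier G)" and card_G: "card (carrier G) = 2 * n\<^sup>2 + 2 * n + 1"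
    and T01: "T \<in> carrier G \<rightarrow>\<^sub>E {0, 1}"
    and T_inv: "T = zgr_power_map G (- 1) T"
    and T_sq: "zgr_mult G T T =
           zgr_add G
             (zgr_diff G (zgr_mult G (zgr_of_int G 2) (zgr_all G)) (zgr_power_map G 2 T))
             (zgr_of_int G (2 * int n))"
    and e_less: "a \<in> carrier G \<Longrightarrow> e a < v"
    and e_mult: "a \<in> carrier G \<Longrightarrow> b \<in> carrier G \<Longrightarrow> [e (a \<otimes>\<^bsub>G\<^esub> b) = e a + e b] (mod v)"
    and e_fibre: "i < v \<Longrightarrow> card {a \<in> carrier G. e a = i} = m"
    and prime_v: "Factorial_Ring.prime v" and prime_p: "Factorial_Ring.prime p" and odd_p: "odd p"
    and p_dvd_n: "p dvd n" and mv: "m * v = 2 * n\<^sup>2 + 2 * n + 1"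
    and gen: "coprime t v \<Longrightarrow> \<exists>i j. [2 ^ i * p ^ j = t] (mod v)"
begin

sublocale G: group G by (rule group_G)

lemma v_gt_1: "v > 1"
  using prime_v prime_gt_1_nat by auto

lemmas odd_v = divisor_of_order_coprime(1)[OF mv]
  and coprime_p_v = divisor_of_order_coprime(2)[OF mv prime_p p_dvd_n]

lemma coprime_gen: "coprime (2 ^ i * p ^ j) v"
  using coprime_p_v odd_v by (simp add: coprime_left_2_iff_odd)

end

text \<open>Only the image of \<open>z\<close> in K is a v-th root of unity, so the character
  relations below hold after applying h. Both the algebraic closure and the given finite field are
  instances.\<close>

locale graded_solution_root = graded_solution G T e n v p m + class_ring_hom K h + domain K
  for G :: "('g, 'b) monoid_scheme" and T :: "'g \<Rightarrow> int" and e :: "'g \<Rightarrow> nat" and n v p m :: nat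
    and K :: "('k, 'c) ring_scheme" (structure) and h :: "'r::comm_ring_1 \<Rightarrow> 'k" +
  fixes z :: 'r
  assumes z_root: "h z [^] v = \<one>" and z_nontriv: "h z \<noteq> \<one>" and h_p: "h (of_nat p) = \<zero>"
begin

lemma h_of_nat_cong: "[a = b] (mod p) \<Longrightarrow> h (of_nat a) = h (of_nat b)"
  using h_of_int_eq_iff[OF prime_p h_p one_not_zero, of "int a" "int b"] by (simp add: cong_int_iff)

lemma h_n: "h (of_nat (2 * n)) = \<zero>"
  using h_of_nat_cong[of "2 * n" 0] p_dvd_n by (simp add: cong_0_iff h_zero)

text \<open>As \<open>p\<close> divides n, this makes \<open>m\<close> the inverse of
  \<open>v\<close> in K, the normalising constant of the Fourier inversion.\<close>

lemma mv_cong: "[m * v = 1] (mod p)"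
proof -
  obtain k where "n = p * k" using p_dvd_n by blast
  then have "m * v = 1 + p * (2 * k * n + 2 * k)" unfolding mv by (simp add: power2_eq_square algebra_simps)
  then show ?thesis unfolding cong_def by (simp only: mod_mult_self2)
qed

lemma h_mv: "h (of_nat m * of_nat v) = \<one>"
  using h_of_nat_cong[OF mv_cong] by (simp add: h_one)

lemma z_power_cong:
  assumes "[a = b] (mod v)" shows "h (z ^ a) = h (z ^ b)"
proof -
  have red: "h (z ^ a) = h (z ^ (a mod v))" for a
  proof -
    have "z ^ a = (z ^ v) ^ (a div v) * z ^ (a mod v)"
      by (simp flip: power_mult power_add)
    then show ?thesis by (simp add: h_mult h_power z_root)
  qed
  from assms have "a mod v = b mod v" by (simp add: cong_def)
  then show ?thesis using red[of a] red[of b] by simp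
qed

lemma z_power_neq_1:
  assumes "\<not> v dvd s" shows "h (z ^ s) \<noteq> \<one>"
proof
  assume s: "h (z ^ s) = \<one>"
  have "coprime s v" using assms prime_v by (metis coprime_commute prime_imp_coprime)
  then obtain r where "[s * r = 1] (mod v)" using cong_solve_coprime_nat by auto
  then have "h (z ^ (s * r)) = h (z ^ 1)" by (rule z_power_cong)
  moreover have "h (z ^ (s * r)) = \<one>" using s by (simp add: power_mult h_power)
  ultimately show False using z_nontriv by simp
qed

lemma geometric_sum:
  "h (\<Sum>t<v. z ^ (t * s)) = (if v dvd s then h (of_nat v) else \<zero>)"
proof (cases "v dvd s")
  case True
  have "h (\<Sum>t<v. z ^ (t * s)) = h (\<Sum>t<v. 1)"
  proof (rule h_sum_cong)
    fix t
    have "[t * s = 0] (mod v)" using True by (simp add: cong_0_iff)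
    from z_power_cong[OF this] show "h (z ^ (t * s)) = h 1" by simp
  qed
  then show ?thesis using True by simp
next
  case False
  have "(z ^ s - 1) * (\<Sum>t<v. (z ^ s) ^ t) = (z ^ s) ^ v - 1"
    by (simp add: power_diff_1_eq)
  then have "h (z ^ s - 1) \<otimes> h (\<Sum>t<v. (z ^ s) ^ t) = h ((z ^ s) ^ v - 1)" by (metis h_mult)
  also have "(z ^ s) ^ v = (z ^ v) ^ s" by (simp flip: power_mult add: mult.commute)
  also have "h ((z ^ v) ^ s - 1) = \<zero>" by (simp add: h_diff h_power z_root h_one)
  finally have "h (z ^ s - 1) = \<zero> \<or> h (\<Sum>t<v. (z ^ s) ^ t) = \<zero>" by (simp add: integral_iff)
  moreover have "h (z ^ s - 1) \<noteq> \<zero>" using z_power_neq_1[OF False] by (simp add: h_diff h_one)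
  ultimately show ?thesis using False by (simp flip: power_mult add: mult.commute)
qed

lemma e_one: "e \<one>\<^bsub>G\<^esub> = 0"
proof -
  have "[e \<one>\<^bsub>G\<^esub> + 0 = e \<one>\<^bsub>G\<^esub> + e \<one>\<^bsub>G\<^esub>] (mod v)" using e_mult[of "\<one>\<^bsub>G\<^esub>" "\<one>\<^bsub>G\<^esub>"] by simp
  then have "[0 = e \<one>\<^bsub>G\<^esub>] (mod v)" unfolding cong_add_lcancel_nat .
  then show ?thesis using e_less[of "\<one>\<^bsub>G\<^esub>"] by (simp add: cong_def)
qed

text \<open>For the character $\chi(a) = h(z)^{e(a)}$, the image of \<open>S t\<close> under \<open>h\<close> is $\chi(T^{(t)})$, and
  \<open>b j\<close> is a coefficient of the image of \<open>T\<close> in the group ring of \<open>G/H\<close>.\<close>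

definition S :: "nat \<Rightarrow> 'r" where
  "S t = (\<Sum>a\<in>carrier G. of_int (T a) * z ^ (t * e a))"

definition b :: "nat \<Rightarrow> int" where
  "b j = (\<Sum>a | a \<in> carrier G \<and> e a = j. T a)"

section \<open>Character values of T in characteristic p\<close>

lemma T_sum: "(\<Sum>a\<in>carrier G. T a) = 2 * int n + 1"
proof -
  define c where "c = (\<Sum>a\<in>carrier G. T a)"
  \<comment> \<open>The augmentation c satisfies c^2 + c = (2n+1)(2n+2), whose only nonnegative
    solution is 2n+1.\<close>
  have "c * c = 2 * int (card (carrier G)) - c + 2 * int n"
    using G.sum_of_square_equation[OF fin T_sq, of "\<lambda>_. 1 :: int"]
    by (simp add: c_def sum_product)
  then have "(c - (2 * int n + 1)) * (c + 2 * int n + 2) = 0"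
    by (simp add: card_G power2_eq_square algebra_simps)
  moreover have "c \<ge> 0" unfolding c_def using T01 by (intro sum_nonneg) (auto simp: PiE_iff)
  ultimately show ?thesis unfolding c_def[symmetric] by auto
qed

lemma h_S_0: "h (S 0) = \<one>"
proof -
  have "S 0 = of_int (\<Sum>a\<in>carrier G. T a)" by (simp add: S_def)
  also have "\<dots> = of_nat (2 * n) + 1" by (simp add: T_sum)
  finally show ?thesis by (simp add: h_add h_n h_one del: of_nat_mult)
qed

lemma S_cong: "[s = t] (mod v) \<Longrightarrow> h (S s) = h (S t)"
  unfolding S_def by (intro h_sum_cong) (simp only: h_mult z_power_cong[OF cong_scalar_right])

lemma sum_characters:
  assumes "\<not> v dvd t" shows "h (\<Sum>a\<in>carrier G. z ^ (t * e a)) = \<zero>"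
proof -
  have "(\<Sum>a\<in>carrier G. z ^ (t * e a)) = (\<Sum>i<v. \<Sum>a\<in>{a\<in>carrier G. e a = i}. z ^ (t * e a))"
    by (rule sum.group[symmetric]) (use fin e_less in auto)
  also have "\<dots> = (\<Sum>i<v. of_nat m * z ^ (i * t))"
    by (intro sum.cong refl) (simp add: e_fibre mult.commute)
  also have "\<dots> = of_nat m * (\<Sum>i<v. z ^ (i * t))" by (rule sum_distrib_left[symmetric])
  finally show ?thesis using geometric_sum[of t] assms by (simp add: h_mult)
qed

lemma S_double:
  assumes t: "\<not> v dvd t" shows "h (- S (2 * t)) = h (- S t) [^] (2::nat)"
proof -
  have "S t ^ 2 = (\<Sum>a\<in>carrier G. \<Sum>b\<in>carrier G. of_int (T a * T b) * z ^ (t * e a + t * e b))"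
    by (simp add: S_def power2_eq_square sum_product power_add algebra_simps)
  then have "h (S t ^ 2) = h (\<Sum>a\<in>carrier G. \<Sum>b\<in>carrier G. of_int (T a * T b) * z ^ (t * e a + t * e b))"
    by simp
  also have "\<dots> = h (\<Sum>a\<in>carrier G. \<Sum>b\<in>carrier G. of_int (T a * T b) * z ^ (t * e (a \<otimes>\<^bsub>G\<^esub> b)))"
  proof (intro h_sum_cong)
    fix a b assume "a \<in> carrier G" "b \<in> carrier G"
    then have "[t * (e a + e b) = t * e (a \<otimes>\<^bsub>G\<^esub> b)] (mod v)"
      by (intro cong_scalar_left cong_sym[OF e_mult])
    then show "h (of_int (T a * T b) * z ^ (t * e a + t * e b)) = h (of_int (T a * T b) * z ^ (t * e (a \<otimes>\<^bsub>G\<^esub> b)))"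
      unfolding h_mult by (simp add: z_power_cong distrib_left)
  qed
  also have "\<dots> = h (2 * (\<Sum>a\<in>carrier G. z ^ (t * e a))
      - (\<Sum>a\<in>carrier G. of_int (T a) * z ^ (t * e (a \<otimes>\<^bsub>G\<^esub> a))) + of_nat (2 * n) * z ^ (t * e \<one>\<^bsub>G\<^esub>))"
    by (subst G.sum_of_square_equation[OF fin T_sq]) simp
  \<comment> \<open>The summand 2G vanishes under a nontrivial character and 2n vanishes in
    characteristic \<open>p\<close>.\<close>
  also have "\<dots> = \<ominus> h (\<Sum>a\<in>carrier G. of_int (T a) * z ^ (t * e (a \<otimes>\<^bsub>G\<^esub> a)))"
    unfolding h_add h_diff h_mult h_n sum_characters[OF t] by (simp add: a_minus_def)
  also have "h (\<Sum>a\<in>carrier G. of_int (T a) * z ^ (t * e (a \<otimes>\<^bsub>G\<^esub> a))) = h (S (2 * t))"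
    unfolding S_def
  proof (intro h_sum_cong)
    fix a assume "a \<in> carrier G"
    then have "[t * e (a \<otimes>\<^bsub>G\<^esub> a) = t * (e a + e a)] (mod v)" by (intro cong_scalar_left e_mult)
    moreover have "t * (e a + e a) = 2 * t * e a" by simp
    ultimately show "h (of_int (T a) * z ^ (t * e (a \<otimes>\<^bsub>G\<^esub> a))) = h (of_int (T a) * z ^ (2 * t * e a))"
      unfolding h_mult by (simp add: z_power_cong)
  qed
  finally have "h (S t ^ 2) = \<ominus> h (S (2 * t))" .
  moreover have "h (- S t) [^] (2::nat) = h (S t ^ 2)" by (simp flip: h_power)
  ultimately show ?thesis by (simp add: h_uminus)
qed

text \<open>The coefficients 0 and 1 are their own p-th powers, so the p-th power acts only on the
  character; \<open>p\<close> being odd carries the sign through.\<close>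

lemma S_frobenius: "h (- S (p * t)) = h (- S t) [^] p"
proof -
  have p0: "p > 0" using prime_p prime_gt_0_nat by auto
  obtain q where q: "S t ^ p = (\<Sum>a\<in>carrier G. (of_int (T a) * z ^ (t * e a)) ^ p) + of_nat p * q"
    using sum_power_prime[OF prime_p fin] unfolding S_def by blast
  have "(\<Sum>a\<in>carrier G. (of_int (T a) * z ^ (t * e a)) ^ p) = S (p * t)"
    unfolding S_def
  proof (intro sum.cong refl)
    fix a assume "a \<in> carrier G"
    then have "T a = 0 \<or> T a = 1" using T01 by auto
    then show "(of_int (T a) * z ^ (t * e a)) ^ p = of_int (T a) * z ^ (p * t * e a)"
      using p0 by (auto simp: power_0_left mult_ac simp flip: power_mult)
  qed
  with q have "(- S t) ^ p = - S (p * t) + of_nat p * (- q)" using odd_p by simp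
  then have "h ((- S t) ^ p) = h (- S (p * t) + of_nat p * (- q))" by simp
  then show ?thesis unfolding h_power h_add h_mult[of "of_nat p"] h_p by simp
qed

lemma S_neg:
  assumes "[s + t = 0] (mod v)" shows "h (S s) = h (S t)"
proof -
  have "h (S s) = h (\<Sum>a\<in>carrier G. of_int (T a) * z ^ (s * e (inv\<^bsub>G\<^esub> a)))"
    using G.sum_symmetric[OF fin T_inv, of "\<lambda>a. z ^ (s * e a)"] by (simp add: S_def)
  also have "\<dots> = h (S t)"
    unfolding S_def
  proof (intro h_sum_cong)
    fix a assume a: "a \<in> carrier G"
    let ?i = "inv\<^bsub>G\<^esub> a"
    have 1: "[e ?i + e a = 0] (mod v)" using e_mult[of ?i a] a e_one by (simp add: cong_sym)
    have "[s * e ?i + (s + t) * e a = s * e ?i + 0 * e a] (mod v)"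
      by (intro cong_add cong_scalar_right assms cong_refl)
    moreover have "s * e ?i + (s + t) * e a = s * (e ?i + e a) + t * e a" by (simp add: algebra_simps)
    moreover have "[s * (e ?i + e a) + t * e a = s * 0 + t * e a] (mod v)"
      by (intro cong_add cong_scalar_left 1 cong_refl)
    ultimately have "[s * e ?i = t * e a] (mod v)" by (simp add: cong_def)
    then show "h (of_int (T a) * z ^ (s * e ?i)) = h (of_int (T a) * z ^ (t * e a))"
      unfolding h_mult by (simp add: z_power_cong)
  qed
  finally show ?thesis .
qed

definition x :: 'k where "x = h (- S 1)"

lemma x_closed [simp]: "x \<in> carrier K"
  by (simp add: x_def)

lemma S_power: "h (- S (2 ^ i * p ^ j)) = x [^] (2 ^ i * p ^ j :: nat)"
proof -
  have "h (- S (p ^ j)) = x [^] (p ^ j)"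
  proof (induction j)
    case 0 show ?case by (simp add: x_def)
  next
    case (Suc j)
    then show ?case using S_frobenius[of "p ^ j"] by (simp add: nat_pow_pow mult.commute)
  qed
  note j = this
  show ?thesis
  proof (induction i)
    case 0 show ?case using j by simp
  next
    case (Suc i)
    \<comment> \<open>The squaring relation holds for nontrivial characters only, so this is checked
      at each doubling; the Frobenius relation carries no such restriction.\<close>
    have "\<not> v dvd 2 ^ i * p ^ j"
      using coprime_gen[of i j] v_gt_1 by (metis coprime_absorb_right nat_dvd_1_iff_1 less_irrefl)
    from S_double[OF this] Suc show ?case by (simp add: nat_pow_pow mult_ac)
  qed
qed

lemma x_power_eq_if_cong:
  assumes "[2 ^ i * p ^ j = 2 ^ i' * p ^ j'] (mod v)"
  shows "x [^] (2 ^ i * p ^ j :: nat) = x [^] (2 ^ i' * p ^ j' :: nat)"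
  using S_cong[OF assms] by (simp flip: S_power add: h_uminus)

lemma x_power_eq_if_neg:
  assumes "[2 ^ i * p ^ j + 2 ^ i' * p ^ j' = 0] (mod v)"
  shows "x [^] (2 ^ i * p ^ j :: nat) = x [^] (2 ^ i' * p ^ j' :: nat)"
  using S_neg[OF assms] by (simp flip: S_power add: h_uminus)

section \<open>Coefficients of the image of T and Fourier inversion\<close>

lemma b_nonneg: "b j \<ge> 0"
  unfolding b_def using T01 by (intro sum_nonneg) (auto simp: PiE_iff)

lemma b_le: "j < v \<Longrightarrow> b j \<le> int m"
proof -
  assume j: "j < v"
  have "b j \<le> (\<Sum>a | a \<in> carrier G \<and> e a = j. 1)"
    unfolding b_def using T01 by (intro sum_mono) (auto simp: PiE_iff)
  then show ?thesis using e_fibre[OF j] by simp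
qed

lemma b_sum: "(\<Sum>j<v. b j) = 2 * int n + 1"
  unfolding b_def T_sum[symmetric] by (rule sum.group) (use fin e_less in auto)

text \<open>With s standing for -j, orthogonality isolates the fibre over j. Division by
  \<open>v\<close> is multiplication by \<open>m\<close>, and the leading 1 is the value
  \<open>h (S 0)\<close> of the trivial character.\<close>

lemma fourier:
  assumes j: "j < v" and s: "[s + j = 0] (mod v)"
  shows "h (of_int (b j)) = h (of_nat m * (1 - (\<Sum>t\<in>{1..<v}. - S t * z ^ (t * s))))"
proof -
  have "(\<Sum>t<v. S t * z ^ (t * s)) = (\<Sum>t<v. \<Sum>a\<in>carrier G. of_int (T a) * z ^ (t * (e a + s)))"
    by (simp add: S_def sum_distrib_right power_add distrib_left mult.assoc)
  also have "\<dots> = (\<Sum>a\<in>carrier G. of_int (T a) * (\<Sum>t<v. z ^ (t * (e a + s))))"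
    by (subst sum.swap) (simp add: sum_distrib_left)
  finally have "h (\<Sum>t<v. S t * z ^ (t * s)) = h (\<Sum>a\<in>carrier G. of_int (T a) * (\<Sum>t<v. z ^ (t * (e a + s))))"
    by simp
  also have "\<dots> = h (\<Sum>a\<in>carrier G. of_int (if e a = j then T a else 0) * of_nat v)"
  proof (intro h_sum_cong)
    fix a assume a: "a \<in> carrier G"
    have "v dvd e a + s \<longleftrightarrow> [e a + s = s + j] (mod v)"
      using s by (metis cong_0_iff cong_sym cong_trans)
    also have "\<dots> \<longleftrightarrow> [e a = j] (mod v)"
      by (metis add.commute cong_add_lcancel_nat)
    also have "\<dots> \<longleftrightarrow> e a = j" using e_less[OF a] j by (simp add: cong_def)
    finally have "v dvd e a + s \<longleftrightarrow> e a = j" .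
    then show "h (of_int (T a) * (\<Sum>t<v. z ^ (t * (e a + s)))) = h (of_int (if e a = j then T a else 0) * of_nat v)"
      unfolding h_mult geometric_sum by (simp add: h_zero)
  qed
  also have "(\<Sum>a\<in>carrier G. of_int (if e a = j then T a else 0) * of_nat v)
      = (of_int (\<Sum>a\<in>carrier G. if e a = j then T a else 0) * of_nat v :: 'r)"
    by (simp add: sum_distrib_right)
  also have "(\<Sum>a\<in>carrier G. if e a = j then T a else 0) = b j"
    unfolding b_def using fin by (simp add: sum.inter_filter)
  finally have 1: "h (\<Sum>t<v. S t * z ^ (t * s)) = h (of_int (b j) * of_nat v)" .
  have "{..<v} = insert 0 {1..<v}" using v_gt_1 by auto
  then have "(\<Sum>t<v. S t * z ^ (t * s)) = S 0 - (\<Sum>t\<in>{1..<v}. - S t * z ^ (t * s))"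
    by (simp add: sum_negf)
  with 1 have 2: "h (of_int (b j) * of_nat v) = h (1 - (\<Sum>t\<in>{1..<v}. - S t * z ^ (t * s)))"
    by (simp add: h_diff h_S_0 h_one)
  have "h (of_int (b j)) = h (of_nat m * of_nat v) \<otimes> h (of_int (b j))" by (simp add: h_mv)
  also have "\<dots> = h (of_nat m) \<otimes> h (of_int (b j) * of_nat v)"
    by (simp flip: h_mult add: mult_ac)
  also have "\<dots> = h (of_nat m * (1 - (\<Sum>t\<in>{1..<v}. - S t * z ^ (t * s))))"
    by (simp only: 2 flip: h_mult)
  finally show ?thesis .
qed

text \<open>Exponents of z may be changed modulo \<open>v\<close>, but those of \<open>x\<close> may
  not: its order need not divide \<open>v\<close>. The residue t is therefore replaced by a
  representative of the form 2^k p^l, for which \<open>S_power\<close> applies. Both index sets in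
  \<open>theta\<close> fit this form.\<close>

lemma inversion_sum_reindex:
  assumes I: "bij_betw (\<lambda>i. r i mod v) I {1..<v}" and r: "\<And>i. i \<in> I \<Longrightarrow> \<exists>k l. r i = 2 ^ k * p ^ l"
  shows "h (\<Sum>t\<in>{1..<v}. - S t * z ^ (t * s)) = (\<Oplus>i\<in>I. (x \<otimes> h (z ^ s)) [^] r i)"
proof -
  have "(\<Sum>t\<in>{1..<v}. - S t * z ^ (t * s)) = (\<Sum>i\<in>I. - S (r i mod v) * z ^ (r i mod v * s))"
    by (rule sum.reindex_bij_betw[OF I, symmetric])
  then have "h (\<Sum>t\<in>{1..<v}. - S t * z ^ (t * s)) = h (\<Sum>i\<in>I. - S (r i mod v) * z ^ (r i mod v * s))" by simp
  also have "\<dots> = h (\<Sum>i\<in>I. (- S 1 * z ^ s) ^ r i)"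
  proof (intro h_sum_cong)
    fix i assume "i \<in> I"
    then obtain k l where r: "r i = 2 ^ k * p ^ l" using r by blast
    have c: "[r i mod v = r i] (mod v)" by simp
    have "h (- S (r i mod v)) = h (- S (r i))" using S_cong[OF c] by (simp add: h_uminus)
    also have "\<dots> = x [^] r i" unfolding r by (rule S_power)
    finally have "h (- S (r i mod v)) = x [^] r i" .
    moreover have "h (z ^ (r i mod v * s)) = h (z ^ (r i * s))"
      by (intro z_power_cong cong_scalar_right c)
    moreover have "h (z ^ (r i * s)) = h (z ^ s) [^] r i"
      unfolding h_power[symmetric] by (simp add: mult.commute flip: power_mult)
    moreover have "h ((- S 1 * z ^ s) ^ r i) = x [^] r i \<otimes> h (z ^ s) [^] r i"
      by (simp only: h_power h_mult x_def[symmetric]) (simp add: nat_pow_distrib)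
    ultimately show "h (- S (r i mod v) * z ^ (r i mod v * s)) = h ((- S 1 * z ^ s) ^ r i)"
      by (simp only: h_mult[of "- S (r i mod v)"])
  qed
  also have "\<dots> = (\<Oplus>i\<in>I. (x \<otimes> h (z ^ s)) [^] r i)"
    unfolding h_sum h_power h_mult x_def by simp
  finally show ?thesis .
qed

lemma S_gen:
  assumes "t \<in> {1..<v}"
  obtains i j where "h (- S t) = x [^] (2 ^ i * p ^ j :: nat)"
proof -
  have "coprime t v" using assms prime_v by (metis atLeastLessThan_iff coprime_commute less_le_trans
        nat_dvd_not_less prime_imp_coprime zero_less_one)
  then obtain i j where "[2 ^ i * p ^ j = t] (mod v)" using gen by blast
  then have "h (- S t) = h (- S (2 ^ i * p ^ j))" using S_cong by (simp add: h_uminus)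
  then show ?thesis using that S_power by simp
qed

section \<open>Excluding degenerate values of x\<close>

lemma x_nonzero:
  assumes m1: "m1 = (LEAST i. [i = m] (mod p))" and bound: "2 * n + 1 < m1 * v"
  shows "x \<noteq> \<zero>"
proof
  assume x0: "x = \<zero>"
  have p0: "p > 0" using prime_p prime_gt_0_nat by auto
  have m1_eq: "m1 \<le> k" if "[k = m] (mod p)" for k unfolding m1 using that by (rule Least_le)
  \<comment> \<open>If \<open>x\<close> is zero, all nontrivial characters vanish and every
    coefficient is \<open>m\<close> modulo \<open>p\<close>. Being nonnegative, each is at least
    \<open>m1\<close>, so their total 2n+1 would be at least m1 * v.\<close>
  have "int m1 \<le> b j" if j: "j < v" for j
  proof -
    define s where "s = v - j"
    have s: "[s + j = 0] (mod v)" using j by (simp add: s_def cong_0_iff)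
    have "h (\<Sum>t\<in>{1..<v}. - S t * z ^ (t * s)) = h (\<Sum>t\<in>{1..<v}. 0)"
    proof (rule h_sum_cong)
      fix t assume "t \<in> {1..<v}"
      then obtain i j where "h (- S t) = x [^] (2 ^ i * p ^ j :: nat)" by (rule S_gen)
      moreover have "2 ^ i * p ^ j \<noteq> (0::nat)" using p0 by simp
      ultimately have "h (- S t) = \<zero>" using x0 by (simp add: nat_pow_zero)
      then show "h (- S t * z ^ (t * s)) = h 0" by (simp only: h_mult h_zero) simp
    qed
    then have "h (of_int (b j)) = h (of_int (int m))"
      unfolding fourier[OF j s] h_mult h_diff by (simp add: h_zero h_one a_minus_def)
    then have "[b j = int m] (mod int p)" using h_of_int_eq_iff[OF prime_p h_p one_not_zero] by blast
    then have "[nat (b j) = m] (mod p)" using b_nonneg[of j] by (simp add: cong_int_iff[symmetric])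
    then show ?thesis using m1_eq[of "nat (b j)"] b_nonneg[of j] by linarith
  qed
  then have "(\<Sum>j<v. int m1) \<le> (\<Sum>j<v. b j)" by (intro sum_mono) simp
  then have "int (m1 * v) \<le> 2 * int n + 1" unfolding b_sum by (simp add: mult.commute)
  then show False using bound by linarith
qed

text \<open>For $x = 1$ the coefficient at the identity is only congruent to $2m - 1$, so the size bound leaves
  the case $m_2 v = 2n + 2$; it is excluded because \<open>v\<close> would divide \<open>n + 1\<close> and $2n(n+1) + 1$.\<close>

lemma x_neq_1:
  assumes m2: "m2 = (LEAST i. [i = 2 * m] (mod p))" and bound: "2 * n + 1 < m2 * v"
  shows "x \<noteq> \<one>"
proof
  assume x1: "x = \<one>"
  have p0: "p > 0" using prime_p prime_gt_0_nat by auto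
  have m2_le: "m2 \<le> k" if "[k = 2 * m] (mod p)" for k unfolding m2 using that by (rule Least_le)
  have b_cong: "[b j = (if j = 0 then 2 * int m - 1 else 2 * int m)] (mod int p)" if j: "j < v" for j
  proof -
    define s where "s = v - j"
    have s: "[s + j = 0] (mod v)" using j by (simp add: s_def cong_0_iff)
    have "h (\<Sum>t\<in>{1..<v}. - S t * z ^ (t * s)) = h (\<Sum>t\<in>{1..<v}. z ^ (t * s))"
    proof (rule h_sum_cong)
      fix t assume "t \<in> {1..<v}"
      then obtain i j where "h (- S t) = x [^] (2 ^ i * p ^ j :: nat)" by (rule S_gen)
      then have "h (- S t) = \<one>" using x1 by simp
      then show "h (- S t * z ^ (t * s)) = h (z ^ (t * s))" by (simp only: h_mult) simp
    qed
    also have "(\<Sum>t\<in>{1..<v}. z ^ (t * s)) = (\<Sum>t<v. z ^ (t * s)) - 1"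
    proof -
      have "{..<v} = insert 0 {1..<v}" using v_gt_1 by auto
      then show ?thesis by simp
    qed
    also have "h ((\<Sum>t<v. z ^ (t * s)) - 1) = h (of_nat (if j = 0 then v else 0) - 1)"
    proof -
      have "v dvd s \<longleftrightarrow> j = 0" using j v_gt_1 unfolding s_def by (auto dest: dvd_imp_le)
      then show ?thesis unfolding h_diff geometric_sum by (simp add: h_zero)
    qed
    finally have "h (of_int (b j)) = h (of_nat m * (1 - (of_nat (if j = 0 then v else 0) - 1)))"
      unfolding fourier[OF j s] h_mult h_diff by simp
    \<comment> \<open>Away from j = 0 the nontrivial characters contribute -1, giving 2m. At j = 0
      there is an extra -m*v, which is -1 modulo \<open>p\<close>.\<close>
    also have "of_nat m * (1 - (of_nat (if j = 0 then v else 0) - 1))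
        = (of_int (if j = 0 then 2 * int m - int m * int v else 2 * int m) :: 'r)"
      by (simp add: algebra_simps)
    finally have "[b j = (if j = 0 then 2 * int m - int m * int v else 2 * int m)] (mod int p)"
      using h_of_int_eq_iff[OF prime_p h_p one_not_zero] by blast
    moreover have "[2 * int m - int m * int v = 2 * int m - 1] (mod int p)"
      using mv_cong by (intro cong_diff cong_refl) (simp flip: cong_int_iff)
    ultimately show ?thesis by (auto intro: cong_trans split: if_splits)
  qed
  have "int m2 \<le> b j" if "j \<in> {1..<v}" for j
  proof -
    have "[b j = 2 * int m] (mod int p)" using b_cong[of j] that by auto
    then have "[nat (b j) = 2 * m] (mod p)" using b_nonneg[of j] by (simp add: cong_int_iff[symmetric])
    then show ?thesis using m2_le[of "nat (b j)"] b_nonneg[of j] by linarith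
  qed
  moreover have "int m2 \<le> b 0 + 1"
  proof -
    have "[b 0 = 2 * int m - 1] (mod int p)" using b_cong[of 0] v_gt_1 by auto
    from cong_add[OF this cong_refl[of 1]] have "[b 0 + 1 = 2 * int m] (mod int p)" by simp
    then have "[nat (b 0 + 1) = 2 * m] (mod p)" using b_nonneg[of 0] by (simp add: cong_int_iff[symmetric])
    then show ?thesis using m2_le[of "nat (b 0 + 1)"] b_nonneg[of 0] by linarith
  qed
  ultimately have "(\<Sum>j\<in>{1..<v}. int m2) + int m2 \<le> (\<Sum>j\<in>{1..<v}. b j) + (b 0 + 1)"
    by (intro add_mono sum_mono) auto
  also have "\<dots> = (\<Sum>j<v. b j) + 1"
  proof -
    have "{..<v} = insert 0 {1..<v}" using v_gt_1 by auto
    then show ?thesis by simp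
  qed
  also have "(\<Sum>j\<in>{1..<v}. int m2) + int m2 = int (m2 * v)"
    using v_gt_1 by (simp add: of_nat_diff algebra_simps)
  finally have "int (m2 * v) \<le> 2 * int n + 2" unfolding b_sum by simp
  then have eq: "m2 * v = 2 * n + 2" using bound by linarith
  have "v dvd m2 * v" by simp
  then have "v dvd 2 * (n + 1)" unfolding eq by simp
  moreover have "coprime v 2" using odd_v by simp
  ultimately have n1: "v dvd n + 1" using coprime_dvd_mult_right_iff by blast
  have "v dvd m * v" by simp
  then have "v dvd 2 * n * (n + 1) + 1" unfolding mv by (simp add: power2_eq_square algebra_simps)
  moreover have "v dvd 2 * n * (n + 1)" using n1 by (rule dvd_mult)
  ultimately have "v dvd 1" using dvd_add_right_iff by blast
  then show False using v_gt_1 by simp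
qed

lemma x_power_v:
  assumes "x [^] v = \<one>" shows "x = \<one>"
proof -
  have "coprime (v - 1) v" by (rule coprime_diff_one_left_nat) (use v_gt_1 in linarith)
  \<comment> \<open>The residue -1 is written as 2^i p^j. Symmetry of T gives x^(2^i p^j) = x, while
    x^(2^i p^j + 1) = 1 because \<open>v\<close> divides that exponent; hence x^2 = 1.\<close>
  then obtain i j where ij: "[2 ^ i * p ^ j = v - 1] (mod v)" using gen by blast
  then have "[2 ^ i * p ^ j + 1 = v - 1 + 1] (mod v)" by (rule cong_add) simp
  then have neg: "[2 ^ i * p ^ j + 1 = 0] (mod v)" using v_gt_1 by (simp add: cong_def)
  have "x [^] (2 ^ i * p ^ j :: nat) = x"
    using x_power_eq_if_neg[of i j 0 0] neg by simp
  moreover obtain c where "2 ^ i * p ^ j + 1 = v * c" using neg by (auto simp: cong_0_iff)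
  then have "x [^] (2 ^ i * p ^ j + 1 :: nat) = \<one>" using assms by (metis nat_pow_one nat_pow_pow x_closed)
  ultimately have xx: "x [^] (2::nat) = \<one>" by (simp add: numeral_2_eq_2)
  obtain k where v: "v = 2 * k + 1" using odd_v by (rule oddE)
  have "x [^] v = (x [^] (2::nat)) [^] k \<otimes> x" unfolding v by (simp add: nat_pow_pow)
  then show ?thesis using assms xx by simp
qed

section \<open>Values of theta at the v-th roots of unity and the order of x\<close>

definition \<Theta> :: "nat \<Rightarrow> 'r" where
  "\<Theta> s = (\<Sum>t\<in>{1..<v}. - S t * z ^ (t * s))"

text \<open>The coefficient at -s, which by \<open>h_\<beta>\<close> is the integer behind m(1 -
  theta) at z^s. The reduction modulo \<open>v\<close> matters for s = 0, where v - s leaves the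
  range of \<open>e\<close>.\<close>

definition \<beta> :: "nat \<Rightarrow> nat" where
  "\<beta> s = nat (b ((v - s) mod v))"

lemma h_\<beta>: "s < v \<Longrightarrow> h (of_nat (\<beta> s)) = h (of_nat m * (1 - \<Theta> s))"
proof -
  assume s: "s < v"
  have "[s + (v - s) mod v = s + (v - s)] (mod v)" by (simp add: cong_def mod_add_right_eq)
  then have "[s + (v - s) mod v = 0] (mod v)" using s by (simp add: cong_def)
  then have "h (of_int (b ((v - s) mod v))) = h (of_nat m * (1 - \<Theta> s))"
    unfolding \<Theta>_def using v_gt_1 by (intro fourier) auto
  moreover have "(of_nat (\<beta> s) :: 'r) = of_int (b ((v - s) mod v))"
    unfolding \<beta>_def using b_nonneg by (simp add: of_nat_nat)
  ultimately show ?thesis by simp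
qed

lemma \<beta>_le: "\<beta> s \<le> m"
  using b_le[of "(v - s) mod v"] v_gt_1 unfolding \<beta>_def by (simp add: nat_le_iff)

lemma \<beta>_sum: "(\<Sum>s<v. \<beta> s) = 2 * n + 1"
proof -
  have "bij_betw (\<lambda>s. (v - s) mod v) {..<v} {..<v}"
  proof (rule bij_betw_byWitness[where f' = "\<lambda>s. (v - s) mod v"])
    have "(v - (v - s) mod v) mod v = s" if "s < v" for s
      using that by (cases "s = 0") auto
    then show "\<forall>s\<in>{..<v}. (v - (v - s) mod v) mod v = s" "\<forall>s\<in>{..<v}. (v - (v - s) mod v) mod v = s" by auto
  qed (use v_gt_1 in auto)
  from sum.reindex_bij_betw[OF this, of "\<lambda>j. nat (b j)"]
  have "(\<Sum>s<v. \<beta> s) = (\<Sum>j<v. nat (b j))" unfolding \<beta>_def .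
  moreover have "int (\<Sum>j<v. nat (b j)) = (\<Sum>j<v. b j)" using b_nonneg by simp
  ultimately show ?thesis using b_sum by linarith
qed

text \<open>Both m * v and the sum 2n+1 of all \<open>\<beta> s\<close> have image 1 in K, and their
  difference is the sum in question.\<close>

lemma h_sum_\<Theta>: "h (of_nat m * (\<Sum>s<v. \<Theta> s)) = \<zero>"
proof -
  have "of_nat m * (\<Sum>s<v. \<Theta> s) = of_nat m * of_nat v - (\<Sum>s<v. of_nat m * (1 - \<Theta> s))"
    by (simp add: right_diff_distrib sum_subtractf sum_distrib_left mult.commute)
  then have "h (of_nat m * (\<Sum>s<v. \<Theta> s)) = \<one> \<ominus> h (\<Sum>s<v. of_nat m * (1 - \<Theta> s))"
    by (simp only: h_diff h_mv)
  also have "h (\<Sum>s<v. of_nat m * (1 - \<Theta> s)) = h (\<Sum>s<v. of_nat (\<beta> s))"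
    by (intro h_sum_cong) (simp add: h_\<beta>)
  also have "(\<Sum>s<v. of_nat (\<beta> s)) = (of_nat (2 * n) + 1 :: 'r)"
    using \<beta>_sum by (metis of_nat_add of_nat_1 of_nat_sum)
  also have "h (of_nat (2 * n) + 1) = \<one>" unfolding h_add h_n h_one by simp
  finally show ?thesis by (simp add: a_minus_def r_neg)
qed

lemma z_powers_eq_iff:
  assumes "s < v" "s' < v" "h (z ^ s) = h (z ^ s')" shows "s = s'"
proof -
  have eq: "s = s'" if "s \<le> s'" "s' < v" "h (z ^ s) = h (z ^ s')" for s s'
  proof (rule ccontr)
    assume "s \<noteq> s'"
    then have "\<not> v dvd s' - s" using that by (auto dest: dvd_imp_le)
    moreover have "h (z ^ (s' - s)) = \<one>"
    proof -
      have "z ^ (s' - s) * z ^ (s + (v - s)) = z ^ s' * z ^ (v - s)"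
        using that by (simp flip: power_add)
      then have "h (z ^ (s' - s)) \<otimes> h (z ^ v) = h (z ^ s) \<otimes> h (z ^ (v - s))"
        using that by (metis h_mult le_add_diff_inverse less_imp_le order.strict_trans1)
      also have "\<dots> = h (z ^ s * z ^ (v - s))" by (simp add: h_mult)
      also have "z ^ s * z ^ (v - s) = z ^ v" using that by (simp flip: power_add)
      finally show ?thesis by (simp add: h_power z_root)
    qed
    ultimately show False using z_power_neq_1 by blast
  qed
  show ?thesis using eq[of s s'] eq[of s' s] assms by (cases "s \<le> s'") auto
qed

lemma v_roots:
  assumes "finite (carrier K)"
  shows "bij_betw (\<lambda>s. h (z ^ s)) {..<v} {y \<in> carrier K. y [^] v = \<one>}"
proof -
  let ?Y = "{y \<in> carrier K. y [^] v = \<one>}"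
  have inj: "inj_on (\<lambda>s. h (z ^ s)) {..<v}" using z_powers_eq_iff by (auto intro: inj_onI)
  have "(h z [^] s) [^] v = \<one>" for s :: nat
  proof -
    have "(h z [^] s) [^] v = (h z [^] v) [^] s" by (simp add: nat_pow_pow mult.commute)
    then show ?thesis by (simp add: z_root)
  qed
  then have sub: "(\<lambda>s. h (z ^ s)) ` {..<v} \<subseteq> ?Y" by (auto simp: h_power)
  have "card ?Y \<le> card ((\<lambda>s. h (z ^ s)) ` {..<v})"
    using num_roots_le_deg[OF assms, of v] v_gt_1 by (simp add: card_image[OF inj])
  then have "(\<lambda>s. h (z ^ s)) ` {..<v} = ?Y" using sub assms by (intro card_seteq) auto
  then show ?thesis using inj by (simp add: bij_betw_def)
qed

text \<open>The sum over nonzero residues hides the case distinction of \<open>theta\<close>: the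
  residues are listed by powers of 2 alone, or by the products 2^i p^j, where the sum over j is the
  trace.\<close>

lemma theta_eq:
  assumes \<zeta>: "primitive_root_of_unity v \<zeta>" and f: "f = ord v p" and d: "d = (v - 1) div f"
  shows "theta \<zeta> v p f d K x (h (z ^ s)) = h (\<Theta> s)"
proof (cases "generate (cyclotomic_gal \<zeta>) {cyclotomic_sigma \<zeta> 2} = carrier (cyclotomic_gal \<zeta>)")
  case True
  have "\<exists>i. [2 ^ i = t] (mod v)" if "coprime t v" for t
  proof -
    have "\<exists>s\<in>range (\<lambda>i. 2 ^ i). [s = t] (mod v)"
    proof (rule residues_generated_if_galois_generated[OF prime_v \<zeta>, of "{2}"])
      show "1 \<in> range (\<lambda>i. 2 ^ i :: nat)" by (rule range_eqI[of _ _ 0]) simp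
      have "2 \<in> range (\<lambda>i. 2 ^ i :: nat)" by (rule range_eqI[of _ _ 1]) simp
      then show "{2} \<subseteq> range (\<lambda>i. 2 ^ i :: nat)" by simp
      show "a * b \<in> range (\<lambda>i. 2 ^ i)" if "a \<in> range (\<lambda>i. 2 ^ i)" "b \<in> range (\<lambda>i. 2 ^ i)" for a b :: nat
        using that by (auto simp flip: power_add)
    qed (use True that odd_v in auto)
    then show ?thesis by auto
  qed
  then have "bij_betw (\<lambda>i. 2 ^ i mod v) {..<v - 1} {1..<v}"
    by (intro bij_betw_powers_of_2 prime_v odd_v)
  then have "h (\<Theta> s) = (\<Oplus>i\<in>{..<v - 1}. (x \<otimes> h (z ^ s)) [^] (2 ^ i :: nat))"
    unfolding \<Theta>_def by (rule inversion_sum_reindex) (metis mult.right_neutral power_0)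
  then show ?thesis using True by (simp add: theta_def)
next
  case False
  define w where "w = - S 1 * z ^ s"
  have hw: "h w = x \<otimes> h (z ^ s)" by (simp only: w_def x_def h_mult)
  let ?r = "\<lambda>(i, j). 2 ^ i * p ^ j :: nat"
  have "bij_betw (\<lambda>(i, j). 2 ^ i * p ^ j mod v) ({..<d} \<times> {..<f}) {1..<v}"
    by (rule bij_betw_powers_of_2_and_p[OF prime_v odd_v coprime_p_v gen f d])
  then have "bij_betw (\<lambda>q. ?r q mod v) ({..<d} \<times> {..<f}) {1..<v}"
    by (simp add: case_prod_unfold)
  then have "h (\<Theta> s) = (\<Oplus>q\<in>{..<d} \<times> {..<f}. (x \<otimes> h (z ^ s)) [^] ?r q)"
    unfolding \<Theta>_def by (rule inversion_sum_reindex) auto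
  also have "\<dots> = h (\<Sum>q\<in>{..<d} \<times> {..<f}. w ^ ?r q)" by (simp only: h_sum h_power hw)
  also have "(\<Sum>q\<in>{..<d} \<times> {..<f}. w ^ ?r q) = (\<Sum>i<d. \<Sum>j<f. (w ^ (2 ^ i)) ^ (p ^ j))"
    by (simp add: sum.cartesian_product case_prod_unfold flip: power_mult)
  also have "h \<dots> = theta \<zeta> v p f d K x (h (z ^ s))"
    using False by (simp add: theta_def finite_field_trace_def h_sum h_power hw)
  finally show ?thesis by simp
qed

text \<open>If p^l is 1 modulo \<open>v\<close>, consistency of the powers of \<open>x\<close> gives
  x^(p^l) = x; if it is -1, the symmetry of T gives the same. The order of \<open>x\<close> thus
  satisfies every condition imposed on r in the definition of \<open>lam\<close>.\<close>

lemma x_order: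
  assumes K: "field K" and x0: "x \<noteq> \<zero>"
    and l: "l = (LEAST i. 1 \<le> i \<and>
               ([int p ^ i = 1] (mod int v) \<or> [int p ^ i = - 1] (mod int v)))"
    and lam: "lam = Max {r. 0 < r \<and> r dvd p ^ l - 1 \<and>
               (\<forall>i j. (i, j) \<noteq> (0, 0) \<longrightarrow> [2 ^ i = p ^ j] (mod v)
                  \<longrightarrow> int r dvd 2 ^ i - int p ^ j)}"
  shows "x [^] (p ^ l - 1) = \<one>" and "x [^] lam = \<one>" and "l \<ge> 1"
proof -
  interpret F: field K by (rule K)
  interpret M: group "Multiplicative_Group.mult_of K" by (rule F.field_mult_group)
  let ?M = "Multiplicative_Group.mult_of K"
  have xM: "x \<in> carrier ?M" using x0 by simp
  have powM: "x [^]\<^bsub>?M\<^esub> (k::nat) = x [^] k" for k by (simp add: Multiplicative_Group.nat_pow_mult_of)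
  have p1: "p > 1" using prime_p prime_gt_1_nat by auto
  have "1 \<le> ord v p \<and> ([int p ^ ord v p = 1] (mod int v) \<or> [int p ^ ord v p = - 1] (mod int v))"
  proof
    show "1 \<le> ord v p" using coprime_p_v by (simp add: Suc_le_eq coprime_commute)
    have "[int (p ^ ord v p) = int 1] (mod int v)" unfolding cong_int_iff by (rule ord)
    then show "[int p ^ ord v p = 1] (mod int v) \<or> [int p ^ ord v p = - 1] (mod int v)" by simp
  qed
  from LeastI[of "\<lambda>i. 1 \<le> i \<and> ([int p ^ i = 1] (mod int v) \<or> [int p ^ i = - 1] (mod int v))", OF this]
  have l1: "1 \<le> l" and lc: "[int p ^ l = 1] (mod int v) \<or> [int p ^ l = - 1] (mod int v)"
    unfolding l[symmetric] by auto
  show "l \<ge> 1" by (rule l1)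
  have pl: "p ^ l > 1" using p1 l1 by (intro one_less_power) auto
  have "x [^] (p ^ l) = x"
    using lc
  proof
    assume "[int p ^ l = 1] (mod int v)"
    then have "[int (p ^ l) = int 1] (mod int v)" by simp
    then have "[p ^ l = 1] (mod v)" unfolding cong_int_iff .
    then show ?thesis using x_power_eq_if_cong[of 0 l 0 0] by simp
  next
    assume "[int p ^ l = - 1] (mod int v)"
    from cong_add[OF this cong_refl[of 1]] have "[int (p ^ l + 1) = int 0] (mod int v)" by (simp add: add.commute)
    then have "[p ^ l + 1 = 0] (mod v)" unfolding cong_int_iff .
    then show ?thesis using x_power_eq_if_neg[of 0 l 0 0] by simp
  qed
  moreover have "p ^ l = Suc (p ^ l - 1)" using pl by simp
  ultimately have "x [^] (p ^ l - 1) \<otimes> x = \<one> \<otimes> x" by (metis l_one nat_pow_Suc x_closed)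
  then show px: "x [^] (p ^ l - 1) = \<one>"
    using x0 by (metis m_rcancel nat_pow_closed one_closed x_closed)
  let ?R = "{r. 0 < r \<and> r dvd p ^ l - 1 \<and>
               (\<forall>i j. (i, j) \<noteq> (0, 0) \<longrightarrow> [2 ^ i = p ^ j] (mod v)
                  \<longrightarrow> int r dvd 2 ^ i - int p ^ j)}"
  define k where "k = M.ord x"
  have "?R \<subseteq> {..p ^ l - 1}" using pl by (auto dest: dvd_imp_le)
  then have finR: "finite ?R" by (rule finite_subset) simp
  have odvd: "k dvd p ^ l - 1" using M.pow_eq_id[OF xM, of "p ^ l - 1"] px powM unfolding k_def by simp
  then have o0: "k > 0" using pl by (cases "k = 0") auto
  have oR: "int k dvd 2 ^ i - int p ^ j" if "[2 ^ i = p ^ j] (mod v)" for i j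
  proof -
    have "x [^] (2 ^ i :: nat) = x [^] (p ^ j)" using x_power_eq_if_cong[of i 0 0 j] that by simp
    then have "x [^]\<^bsub>?M\<^esub> int (p ^ j) = x [^]\<^bsub>?M\<^esub> int (2 ^ i)" by (simp only: int_pow_int powM)
    then show ?thesis using M.int_pow_eq[OF xM, of "int (p ^ j)" "int (2 ^ i)"] unfolding k_def by simp
  qed
  have "k \<in> ?R" using o0 odvd oR by auto
  have "lam \<in> ?R" unfolding lam using finR \<open>k \<in> ?R\<close> by (intro Max_in) auto
  \<comment> \<open>A maximum is not automatically a common multiple. Since the conditions on r are
    divisibilities, the lcm of two admissible numbers is admissible, and maximality turns into k
    dividing \<open>lam\<close>.\<close>
  have "lcm k lam \<in> ?R"
  proof (intro CollectI conjI allI impI)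
    show "0 < lcm k lam" using o0 \<open>lam \<in> ?R\<close> by (simp add: lcm_pos_nat)
    show "lcm k lam dvd p ^ l - 1" using odvd \<open>lam \<in> ?R\<close> by simp
    fix i j :: nat assume "(i, j) \<noteq> (0, 0)" "[2 ^ i = p ^ j] (mod v)"
    then have "int k dvd 2 ^ i - int p ^ j" "int lam dvd 2 ^ i - int p ^ j" using oR \<open>lam \<in> ?R\<close> by auto
    then show "int (lcm k lam) dvd 2 ^ i - int p ^ j" by (simp flip: lcm_int_int_eq)
  qed
  then have "lcm k lam \<le> lam" unfolding lam using finR by (intro Max_ge)
  moreover have "lam dvd lcm k lam" "0 < lcm k lam" using \<open>lcm k lam \<in> ?R\<close> by auto
  ultimately have "lcm k lam = lam" using dvd_imp_le[of lam "lcm k lam"] by linarith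
  then have "k dvd lam" by (metis dvd_lcm1)
  then show "x [^] lam = \<one>" using M.pow_eq_id[OF xM, of lam] powM unfolding k_def by simp
qed

lemma theta_values:
  assumes fin_K: "finite (carrier K)" and theta: "\<And>s. s < v \<Longrightarrow> \<theta> (h (z ^ s)) = h (\<Theta> s)"
  shows "[m] \<cdot> (\<Oplus>y\<in>{y \<in> carrier K. y [^] v = \<one>}. \<theta> y) = \<zero>"
    and "\<And>y. y \<in> carrier K \<Longrightarrow> y [^] v = \<one> \<Longrightarrow> \<exists>k\<in>{0..m}. [m] \<cdot> (\<one> \<ominus> \<theta> y) = [k] \<cdot> \<one>"
    and "m = 1 \<Longrightarrow> card {y \<in> carrier K. \<theta> y = \<one> \<and> y [^] v = \<one>} = 2 * n\<^sup>2"
    and "m = 1 \<Longrightarrow> card {y \<in> carrier K. \<theta> y = \<zero> \<and> y [^] v = \<one>} = 2 * n + 1"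
proof -
  note bij = v_roots[OF fin_K]
  have inj: "inj_on (\<lambda>s. h (z ^ s)) {..<v}" and img: "(\<lambda>s. h (z ^ s)) ` {..<v} = {y \<in> carrier K. y [^] v = \<one>}"
    using bij by (simp_all add: bij_betw_def)
  have "(\<Oplus>y\<in>{y \<in> carrier K. y [^] v = \<one>}. \<theta> y) = (\<Oplus>s\<in>{..<v}. \<theta> (h (z ^ s)))"
    unfolding img[symmetric] by (rule finsum_reindex[OF _ inj]) (auto simp: theta)
  also have "\<dots> = h (\<Sum>s<v. \<Theta> s)"
    unfolding h_sum by (intro finsum_cong') (auto simp: theta)
  finally show "[m] \<cdot> (\<Oplus>y\<in>{y \<in> carrier K. y [^] v = \<one>}. \<theta> y) = \<zero>"
    using h_sum_\<Theta> by (simp add: h_nat_multiple)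
  have key: "[m] \<cdot> (\<one> \<ominus> \<theta> (h (z ^ s))) = h (of_nat (\<beta> s))" if "s < v" for s
  proof -
    have "\<one> \<ominus> \<theta> (h (z ^ s)) = h (1 - \<Theta> s)" using that by (simp add: theta h_diff h_one)
    then show ?thesis using that by (simp add: h_nat_multiple h_\<beta>)
  qed
  show "\<exists>k\<in>{0..m}. [m] \<cdot> (\<one> \<ominus> \<theta> y) = [k] \<cdot> \<one>" if "y \<in> carrier K" "y [^] v = \<one>" for y
  proof -
    have "y \<in> (\<lambda>s. h (z ^ s)) ` {..<v}" using that img by simp
    then obtain s where "s < v" "y = h (z ^ s)" by auto
    then have "[m] \<cdot> (\<one> \<ominus> \<theta> y) = [\<beta> s] \<cdot> \<one>" using key h_of_nat by simp
    then show ?thesis using \<beta>_le[of s] by (intro bexI[of _ "\<beta> s"]) auto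
  qed
  assume m: "m = 1"
  \<comment> \<open>For m = 1 the coefficients are 0 or 1 and theta is 1 minus the coefficient. The
    zeros of theta are thus counted by the coefficient sum 2n+1, and the remaining v - (2n+1) = 2n^2
    points give the value 1.\<close>
  have val: "\<theta> (h (z ^ s)) = (if \<beta> s = 0 then \<one> else \<zero>)" and \<beta>01: "\<beta> s = 0 \<or> \<beta> s = 1" if s: "s < v" for s
  proof -
    show "\<beta> s = 0 \<or> \<beta> s = 1" using \<beta>_le[of s] m by auto
    moreover have "\<one> \<ominus> h (\<Theta> s) = h (of_nat (\<beta> s))"
      using h_\<beta>[OF s] unfolding m h_mult h_diff by (simp add: h_one)
    moreover have "h (\<Theta> s) = \<one> \<ominus> (\<one> \<ominus> h (\<Theta> s))"
    proof -
      have "y = \<one> \<ominus> (\<one> \<ominus> y)" if "y \<in> carrier K" for y using that by algebra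
      then show ?thesis by simp
    qed
    ultimately show "\<theta> (h (z ^ s)) = (if \<beta> s = 0 then \<one> else \<zero>)"
      using theta[OF s] by (auto simp: h_zero h_one a_minus_def r_neg)
  qed
  have cards: "card {y \<in> carrier K. \<theta> y = c \<and> y [^] v = \<one>} = card {s \<in> {..<v}. \<theta> (h (z ^ s)) = c}" for c
  proof -
    have "{y \<in> carrier K. \<theta> y = c \<and> y [^] v = \<one>} = (\<lambda>s. h (z ^ s)) ` {s \<in> {..<v}. \<theta> (h (z ^ s)) = c}"
    proof -
      have "{y \<in> carrier K. \<theta> y = c \<and> y [^] v = \<one>} = {y \<in> (\<lambda>s. h (z ^ s)) ` {..<v}. \<theta> y = c}"
        unfolding img by auto
      also have "\<dots> = (\<lambda>s. h (z ^ s)) ` {s \<in> {..<v}. \<theta> (h (z ^ s)) = c}" by auto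
      finally show ?thesis .
    qed
    moreover have "inj_on (\<lambda>s. h (z ^ s)) {s \<in> {..<v}. \<theta> (h (z ^ s)) = c}"
      by (rule inj_on_subset[OF inj]) auto
    ultimately show ?thesis by (simp only: card_image)
  qed
  have "(\<Sum>s<v. \<beta> s) = (\<Sum>s<v. if \<theta> (h (z ^ s)) = \<zero> then 1 else 0)"
  proof (intro sum.cong refl)
    fix s assume "s \<in> {..<v}"
    then show "\<beta> s = (if \<theta> (h (z ^ s)) = \<zero> then 1 else 0)" using val[of s] \<beta>01[of s] by auto
  qed
  also have "\<dots> = card {s \<in> {..<v}. \<theta> (h (z ^ s)) = \<zero>}" by (simp add: sum.If_cases Int_def)
  finally have zero: "card {s \<in> {..<v}. \<theta> (h (z ^ s)) = \<zero>} = 2 * n + 1" using \<beta>_sum by simp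
  then show "card {y \<in> carrier K. \<theta> y = \<zero> \<and> y [^] v = \<one>} = 2 * n + 1" unfolding cards .
  have "{s \<in> {..<v}. \<theta> (h (z ^ s)) = \<one>} = {..<v} - {s \<in> {..<v}. \<theta> (h (z ^ s)) = \<zero>}"
    by (auto simp: val split: if_splits)
  moreover have sub: "{s \<in> {..<v}. \<theta> (h (z ^ s)) = \<zero>} \<subseteq> {..<v}" by blast
  ultimately have "card {s \<in> {..<v}. \<theta> (h (z ^ s)) = \<one>} = v - (2 * n + 1)"
    using card_Diff_subset[OF finite_subset[OF sub] sub] zero by simp
  also have "\<dots> = 2 * n\<^sup>2" using mv m by simp
  finally show "card {y \<in> carrier K. \<theta> y = \<one> \<and> y [^] v = \<one>} = 2 * n\<^sup>2" unfolding cards .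
qed

end

section \<open>The two fields of application and the final statement\<close>

lemma (in graded_solution) graded_solution_root_int_poly:
  assumes "field K" "[p] \<cdot>\<^bsub>K\<^esub> \<one>\<^bsub>K\<^esub> = \<zero>\<^bsub>K\<^esub>" "y \<in> carrier K" "y [^]\<^bsub>K\<^esub> v = \<one>\<^bsub>K\<^esub>" "y \<noteq> \<one>\<^bsub>K\<^esub>"
  shows "graded_solution_root G T e n v p m K (int_poly_eval K y) [:0, 1:]"
proof -
  interpret F: field K by fact
  interpret E: class_ring_hom K "int_poly_eval K y" by (rule F.class_ring_hom_int_poly_eval) fact
  show ?thesis
    by unfold_locales (use assms in \<open>simp_all add: F.int_poly_eval_X E.h_of_nat\<close>)
qed

theorem theorem7:
  fixes n p v f l d m m1 m2 lam :: nat
    and G :: "('a, 'b) monoid_scheme" and H :: "'a set"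
    and \<zeta> :: complex and T :: "'a \<Rightarrow> int"
  assumes "n > 0" and "Factorial_Ring.prime p" and "p dvd 2 * n"
    and "comm_group G" and "card (carrier G) = 2 * n\<^sup>2 + 2 * n + 1"
    and "subgroup H G" and "card (rcosets\<^bsub>G\<^esub> H) = v" and "Factorial_Ring.prime v"
    and "f = ord v p"
    and "l = (LEAST i. 1 \<le> i \<and>
               ([int p ^ i = 1] (mod int v) \<or> [int p ^ i = - 1] (mod int v)))"
    and "d = (v - 1) div f"
    and "m = (2 * n\<^sup>2 + 2 * n + 1) div v"
    and "m1 = (LEAST i. [i = m] (mod p))"
    and "m2 = (LEAST i. [i = 2 * m] (mod p))"
    and "lam = Max {r. 0 < r \<and> r dvd p ^ l - 1 \<and>
               (\<forall>i j. (i, j) \<noteq> (0, 0) \<longrightarrow> [2 ^ i = p ^ j] (mod v)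
                  \<longrightarrow> int r dvd 2 ^ i - int p ^ j)}"
    and "2 * n + 1 < m1 * v" and "2 * n + 1 < m2 * v"
    and "primitive_root_of_unity v \<zeta>"
    and "generate (cyclotomic_gal \<zeta>) {cyclotomic_sigma \<zeta> 2, cyclotomic_sigma \<zeta> p}
           = carrier (cyclotomic_gal \<zeta>)"
    and "T \<in> carrier G \<rightarrow>\<^sub>E {0, 1}"
    and "T = zgr_power_map G (- 1) T"
    and "zgr_mult G T T =
           zgr_add G
             (zgr_diff G (zgr_mult G (zgr_of_int G 2) (zgr_all G)) (zgr_power_map G 2 T))
             (zgr_of_int G (2 * int n))"
  shows "(lam \<noteq> 1 \<and> lam \<noteq> v) \<and>
    (\<forall>(K :: 'k ring) L.
       field K \<and> card (carrier K) = p ^ f \<and> subfield L K \<and> card L = p ^ l \<longrightarrow>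
       (\<exists>x\<in>{z \<in> L. z [^]\<^bsub>K\<^esub> lam = \<one>\<^bsub>K\<^esub>}.
          [m] \<cdot>\<^bsub>K\<^esub> (\<Oplus>\<^bsub>K\<^esub>y\<in>{y \<in> carrier K. y [^]\<^bsub>K\<^esub> v = \<one>\<^bsub>K\<^esub>}. theta \<zeta> v p f d K x y)
            = \<zero>\<^bsub>K\<^esub> \<and>
          (\<forall>y\<in>carrier K. y [^]\<^bsub>K\<^esub> v = \<one>\<^bsub>K\<^esub> \<longrightarrow>
             (\<exists>k\<in>{0..m}. [m] \<cdot>\<^bsub>K\<^esub> (\<one>\<^bsub>K\<^esub> \<ominus>\<^bsub>K\<^esub> theta \<zeta> v p f d K x y) = [k] \<cdot>\<^bsub>K\<^esub> \<one>\<^bsub>K\<^esub>))) \<and>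
       (H = {\<one>\<^bsub>G\<^esub>} \<longrightarrow>
          (\<exists>x\<in>{z \<in> L. z [^]\<^bsub>K\<^esub> lam = \<one>\<^bsub>K\<^esub>}.
             card {y \<in> carrier K. theta \<zeta> v p f d K x y = \<one>\<^bsub>K\<^esub>
                     \<and> y [^]\<^bsub>K\<^esub> (2 * n\<^sup>2 + 2 * n + 1) = \<one>\<^bsub>K\<^esub>} = 2 * n\<^sup>2 \<and>
             card {y \<in> carrier K. theta \<zeta> v p f d K x y = \<zero>\<^bsub>K\<^esub>
                     \<and> y [^]\<^bsub>K\<^esub> (2 * n\<^sup>2 + 2 * n + 1) = \<one>\<^bsub>K\<^esub>} = 2 * n + 1)))"
proof -
  interpret G: comm_group G by fact
  let ?N = "2 * n\<^sup>2 + 2 * n + 1"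
  have v1: "v > 1" using assms(8) prime_gt_1_nat by auto
  have p1: "p > 1" using assms(2) prime_gt_1_nat by auto
  have fin: "finite (carrier G)" using assms(5) by (metis card.infinite add_is_0 zero_neq_one)
  have lagrange: "v * card H = ?N"
    using G.lagrange[OF assms(6)] assms(5,7) by (simp add: Coset.order_def)
  then have mH: "m = card H" using assms(12) v1 by (metis nonzero_mult_div_cancel_left not_one_less_zero)
  then have mv: "m * v = ?N" using lagrange by (simp add: mult.commute)
  have "m2 \<noteq> 0" using assms(17) by (metis mult_0 not_less_zero)
  \<comment> \<open>For p = 2 the least residue of 2m is 0, contradicting 2n + 1 < m2 * v.\<close>
  have odd_p: "odd p"
  proof
    assume "even p"
    then have "p = 2" using assms(2) primes_dvd_imp_eq two_is_prime_nat by blast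
    then have "[0 = 2 * m] (mod p)" by (simp add: cong_def)
    then have "m2 \<le> 0" unfolding assms(14) by (rule Least_le)
    then show False using \<open>m2 \<noteq> 0\<close> by simp
  qed
  then have p_dvd_n: "p dvd n" using assms(3) by (simp add: coprime_dvd_mult_right_iff)
  note odd_v = divisor_of_order_coprime(1)[OF mv]
    and pv = divisor_of_order_coprime(2)[OF mv assms(2) p_dvd_n]
  have gen: "\<exists>i j. [2 ^ i * p ^ j = t] (mod v)" if t: "coprime t v" for t
  proof -
    let ?S = "range (\<lambda>(i, j). 2 ^ i * p ^ j)"
    have "\<exists>s\<in>?S. [s = t] (mod v)"
    proof (rule residues_generated_if_galois_generated[OF assms(8) assms(18), of "{2, p}"])
      show "1 \<in> ?S" by (rule range_eqI[of _ _ "(0, 0)"]) simp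
      have "2 \<in> ?S" by (rule range_eqI[of _ _ "(1, 0)"]) simp
      moreover have "p \<in> ?S" by (rule range_eqI[of _ _ "(0, 1)"]) simp
      ultimately show "{2, p} \<subseteq> ?S" by blast
      show "a * b \<in> ?S" if ab: "a \<in> ?S" "b \<in> ?S" for a b
      proof -
        from ab obtain i j k l where "a = 2 ^ i * p ^ j" "b = 2 ^ k * p ^ l" by auto
        then have "a * b = 2 ^ (i + k) * p ^ (j + l)" by (simp add: power_add)
        then show ?thesis by (intro range_eqI[of _ _ "(i + k, j + l)"]) simp
      qed
    qed (use assms(19) odd_v pv t in \<open>auto simp: coprime_left_2_iff_odd\<close>)
    then show ?thesis by auto
  qed
  obtain e where e: "\<And>a. a \<in> carrier G \<Longrightarrow> e a < v"
    "\<And>a b. a \<in> carrier G \<Longrightarrow> b \<in> carrier G \<Longrightarrow> [e (a \<otimes>\<^bsub>G\<^esub> b) = e a + e b] (mod v)"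
    "\<And>i. i < v \<Longrightarrow> card {a \<in> carrier G. e a = i} = card H"
    using G.exists_cyclic_grading[OF fin assms(6,7,8)] by blast
  interpret D: graded_solution G T e n v p m
    by unfold_locales (use assms(2,5,8,20-22) fin e mH odd_p p_dvd_n mv gen in auto)

  \<comment> \<open>Here x^lam = 1 and x is not 1: this rules out lam = 1 at once and lam = v by
    \<open>x_power_v\<close>. The field is the constructed closure, since no K is at hand.\<close>
  have lam_bounds: "lam \<noteq> 1 \<and> lam \<noteq> v"
  proof -
    have "\<not> p dvd v" using pv p1 by (metis coprime_absorb_left nat_dvd_1_iff_1 less_irrefl)
    then obtain K :: "((int list \<times> nat) multiset \<Rightarrow> int) ring" and y where
      K: "field K" "[p] \<cdot>\<^bsub>K\<^esub> \<one>\<^bsub>K\<^esub> = \<zero>\<^bsub>K\<^esub>" "y \<in> carrier K" "y [^]\<^bsub>K\<^esub> v = \<one>\<^bsub>K\<^esub>" "y \<noteq> \<one>\<^bsub>K\<^esub>"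
      using exists_field_with_root_of_unity[OF assms(2) v1] by blast
    interpret K: graded_solution_root G T e n v p m K "int_poly_eval K y" "[:0, 1:]"
      by (rule D.graded_solution_root_int_poly[OF K])
    have "K.x \<noteq> \<one>\<^bsub>K\<^esub>" by (rule K.x_neq_1[OF assms(14,17)])
    moreover have "K.x [^]\<^bsub>K\<^esub> lam = \<one>\<^bsub>K\<^esub>"
      by (rule K.x_order(2)[OF K(1) K.x_nonzero[OF assms(13,16)] assms(10,15)])
    ultimately show ?thesis using K.x_power_v by auto
  qed
  \<comment> \<open>One and the same x serves parts (ii) and (iii), so both claims are put under a
    single existential quantifier.\<close>
  moreover have "\<exists>x\<in>{z \<in> L. z [^]\<^bsub>K\<^esub> lam = \<one>\<^bsub>K\<^esub>}.
          ([m] \<cdot>\<^bsub>K\<^esub> (\<Oplus>\<^bsub>K\<^esub>y\<in>{y \<in> carrier K. y [^]\<^bsub>K\<^esub> v = \<one>\<^bsub>K\<^esub>}. theta \<zeta> v p f d K x y)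
            = \<zero>\<^bsub>K\<^esub> \<and>
          (\<forall>y\<in>carrier K. y [^]\<^bsub>K\<^esub> v = \<one>\<^bsub>K\<^esub> \<longrightarrow>
             (\<exists>k\<in>{0..m}. [m] \<cdot>\<^bsub>K\<^esub> (\<one>\<^bsub>K\<^esub> \<ominus>\<^bsub>K\<^esub> theta \<zeta> v p f d K x y) = [k] \<cdot>\<^bsub>K\<^esub> \<one>\<^bsub>K\<^esub>))) \<and>
          (H = {\<one>\<^bsub>G\<^esub>} \<longrightarrow>
             card {y \<in> carrier K. theta \<zeta> v p f d K x y = \<one>\<^bsub>K\<^esub> \<and> y [^]\<^bsub>K\<^esub> ?N = \<one>\<^bsub>K\<^esub>} = 2 * n\<^sup>2 \<and>
             card {y \<in> carrier K. theta \<zeta> v p f d K x y = \<zero>\<^bsub>K\<^esub> \<and> y [^]\<^bsub>K\<^esub> ?N = \<one>\<^bsub>K\<^esub>} = 2 * n + 1)"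
    if KL: "field K \<and> card (carrier K) = p ^ f \<and> subfield L K \<and> card L = p ^ l" for K :: "'k ring" and L
  proof -
    interpret F: field K using KL by blast
    have f0: "f > 0" using pv assms(9) by (simp add: coprime_commute)
    have pf: "p ^ f > 1" using p1 f0 by (metis one_less_power)
    have cardK: "card (carrier K) = p ^ f" using KL by blast
    then have finK: "finite (carrier K)" using pf by (metis card.infinite not_one_less_zero)
    have "[p ^ f = 1] (mod v)" unfolding assms(9) by (rule ord)
    then have "v dvd p ^ f - 1" using pf by (simp add: cong_altdef_nat)
    then obtain y where y: "y \<in> carrier K" "y [^]\<^bsub>K\<^esub> v = \<one>\<^bsub>K\<^esub>" "y \<noteq> \<one>\<^bsub>K\<^esub>"
      using F.finite_field_char_and_root(2)[OF cardK assms(2) f0 v1] by blast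
    interpret K: graded_solution_root G T e n v p m K "int_poly_eval K y" "[:0, 1:]"
      by (rule D.graded_solution_root_int_poly[OF F.field_axioms F.finite_field_char_and_root(1)[OF cardK assms(2) f0] y])
    note order = K.x_order[OF F.field_axioms K.x_nonzero[OF assms(13,16)] assms(10,15)]
    have pl: "p ^ l > 1" using p1 order(3) by (intro one_less_power) auto
    \<comment> \<open>Membership in the subfield L comes from x^(p^l - 1) = 1 alone, since L
      contains all solutions of that equation.\<close>
    have xL: "K.x \<in> {z \<in> L. z [^]\<^bsub>K\<^esub> lam = \<one>\<^bsub>K\<^esub>}"
      using F.subfield_mem_if_power_eq_1[OF finK, of L "p ^ l" K.x] KL pl order by simp
    note vals = K.theta_values[OF finK K.theta_eq[OF assms(18,9,11)]]
    have "m = 1 \<and> v = ?N" if "H = {\<one>\<^bsub>G\<^esub>}" using that mH mv by simp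
    then show ?thesis using vals by (intro bexI[OF _ xL]) auto
  qed
  ultimately show ?thesis by blast
qed

end
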